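(* Let $[a,b]\subset[0,1]$, $c\in(0,1]$, $K=\{u\in\mathcal C([0,1]): u\ge 0,\ \min_{t\in[a,b]}u(t)\ge c\|u\|\}$ with the supremum norm. Assume: (H1) $f:[0,1]\times[0,\infty)\to[0,\infty)$ is such that $f(\cdot,u(\cdot))$ is measurable whenever $u\in\mathcal C([0,1])$, and for each $r>0$ there is $R>0$ with $f(t,u)\le R$ for a.a. $t\in[0,1]$ and all $u\in[0,r]$; (H2) $g$ is measurable and $g\ge 0$ a.e.; (H3) $k:[0,1]\times[0,1]\to[0,\infty)$ is continuous; (H4) there is a measurable $\Phi:[0,1]\to[0,\infty)$ with $\Phi g\in L^1(0,1)$, $\int_a^b\Phi g>0$, $k(t,s)\le\Phi(s)$ for all $t,s\in[0,1]$ and $c\Phi(s)\le k(t,s)$ for $t\in[a,b]$, $s\in[0,1]$. Let $T:K\to K$ be the Hammerstein operator $Tu(t)=\int_0^1k(t,s)g(s)f(s,u(s))\,ds$ with closed--convex envelope $\mathbb T$, and assume $\{u\}\cap\mathbb{T}u\subset\{Tu\}$ for all $u\in K\cap\mathbb{T}K$. Then $T$ has at least one positive fixed point in $K$ if either of the following holds: (a) there exist $\rho_1,\rho_2\in(0,\infty)$ with $\rho_1/c<\rho_2$ such that $(I^0_{\rho_1})$ and $(I^1_{\rho_2})$ hold; (b) there exist $\rho_1,\rho_2\in(0,\infty)$ with $\rho_1<\rho_2$ such that $(I^1_{\rho_1})$ and $(I^0_{\rho_2})$ hold.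
   Context: The closed--convex envelope of $T:K\to K$ is $\mathbb{T}u=\bigcap_{\varepsilon>0}\overline{\mathrm{co}}\,T\big(\overline B_\varepsilon(u)\cap K\big)$ ($\overline B_\varepsilon(u)$ closed ball, $\overline{\mathrm{co}}$ closed convex hull), $\mathbb TK=\bigcup_{u\in K}\mathbb Tu$. Condition $(I^1_\rho)$: there exists $\varepsilon>0$ such that $f^{\rho,\varepsilon}<m$, where $f^{\rho,\varepsilon}=\sup_{0\le t\le1,\,0\le u\le\rho+\varepsilon}f(t,u)/\rho$ and $1/m=\sup_{t\in[0,1]}\int_0^1k(t,s)g(s)\,ds$. Condition $(I^0_\rho)$: there exists $\varepsilon>0$ such that $f_{\rho,\varepsilon}>M(a,b)$, where $f_{\rho,\varepsilon}=\inf_{a\le t\le b,\ c(\rho-\varepsilon)\le u\le\rho/c+\varepsilon}f(t,u)/\rho$ and $1/M(a,b)=\inf_{t\in[a,b]}\int_a^bk(t,s)g(s)\,ds$. *)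

theory Defs
  imports "HOL-Analysis.Analysis"
begin

text \<open>Elements of C([0,1]) are represented as functions real => real that are
continuous on [0,1] and vanish outside [0,1] (so equality of elements is
equality of functions).\<close>

definition C01 :: "(real \<Rightarrow> real) set" where
  "C01 = {u. continuous_on {0..1} u \<and> (\<forall>t. t \<notin> {0..1} \<longrightarrow> u t = 0)}"

definition supnorm :: "(real \<Rightarrow> real) \<Rightarrow> real" where
  "supnorm u = (SUP t\<in>{0..1}. \<bar>u t\<bar>)"

definition coneK :: "real \<Rightarrow> real \<Rightarrow> real \<Rightarrow> (real \<Rightarrow> real) set" where
  "coneK a b c = {u \<in> C01. (\<forall>t\<in>{0..1}. 0 \<le> u t) \<and> (INF t\<in>{a..b}. u t) \<ge> c * supnorm u}"

definition hammerstein ::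
  "(real \<Rightarrow> real \<Rightarrow> real) \<Rightarrow> (real \<Rightarrow> real) \<Rightarrow> (real \<Rightarrow> real \<Rightarrow> real)
     \<Rightarrow> (real \<Rightarrow> real) \<Rightarrow> (real \<Rightarrow> real)" where
  "hammerstein k g f u = (\<lambda>t. if t \<in> {0..1}
      then integral\<^sup>L (lebesgue_on {0..1}) (\<lambda>s. k t s * g s * f s (u s)) else 0)"

definition cball_sup :: "(real \<Rightarrow> real) \<Rightarrow> real \<Rightarrow> (real \<Rightarrow> real) set" where
  "cball_sup u e = {v \<in> C01. supnorm (\<lambda>t. v t - u t) \<le> e}"

definition fconvex :: "(real \<Rightarrow> real) set \<Rightarrow> bool" where
  "fconvex S \<longleftrightarrow> (\<forall>x\<in>S. \<forall>y\<in>S. \<forall>\<mu>\<in>{0..1::real}. (\<lambda>t. \<mu> * x t + (1 - \<mu>) * y t) \<in> S)"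

definition closure_sup :: "(real \<Rightarrow> real) set \<Rightarrow> (real \<Rightarrow> real) set" where
  "closure_sup S = {v \<in> C01. \<forall>e>0. \<exists>w\<in>S. supnorm (\<lambda>t. v t - w t) < e}"

definition cco :: "(real \<Rightarrow> real) set \<Rightarrow> (real \<Rightarrow> real) set" where
  "cco S = closure_sup (fconvex hull S)"

definition envelope ::
  "((real \<Rightarrow> real) \<Rightarrow> (real \<Rightarrow> real)) \<Rightarrow> (real \<Rightarrow> real) set \<Rightarrow> (real \<Rightarrow> real) \<Rightarrow> (real \<Rightarrow> real) set" where
  "envelope T K u = (\<Inter>e\<in>{e::real. e > 0}. cco (T ` (cball_sup u e \<inter> K)))"

definition envelope_set ::
  "((real \<Rightarrow> real) \<Rightarrow> (real \<Rightarrow> real)) \<Rightarrow> (real \<Rightarrow> real) set \<Rightarrow> (real \<Rightarrow> real) set" where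
  "envelope_set T K = (\<Union>u\<in>K. envelope T K u)"

definition m_const :: "(real \<Rightarrow> real \<Rightarrow> real) \<Rightarrow> (real \<Rightarrow> real) \<Rightarrow> real" where
  "m_const k g = 1 / (SUP t\<in>{0..1}. integral\<^sup>L (lebesgue_on {0..1}) (\<lambda>s. k t s * g s))"

definition M_const :: "(real \<Rightarrow> real \<Rightarrow> real) \<Rightarrow> (real \<Rightarrow> real) \<Rightarrow> real \<Rightarrow> real \<Rightarrow> real" where
  "M_const k g a b = 1 / (INF t\<in>{a..b}. integral\<^sup>L (lebesgue_on {a..b}) (\<lambda>s. k t s * g s))"

definition cond_I1 ::
  "(real \<Rightarrow> real \<Rightarrow> real) \<Rightarrow> (real \<Rightarrow> real \<Rightarrow> real) \<Rightarrow> (real \<Rightarrow> real) \<Rightarrow> real \<Rightarrow> bool" where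
  "cond_I1 f k g \<rho> \<longleftrightarrow> (\<exists>\<epsilon>>0.
     (SUP p\<in>{0..1} \<times> {0..\<rho> + \<epsilon>}. ereal (f (fst p) (snd p) / \<rho>)) < ereal (m_const k g))"

text \<open>Condition (I^0_rho); the inf is taken in the extended reals, and only over
u >= 0 (the domain of f).\<close>
definition cond_I0 ::
  "(real \<Rightarrow> real \<Rightarrow> real) \<Rightarrow> (real \<Rightarrow> real \<Rightarrow> real) \<Rightarrow> (real \<Rightarrow> real) \<Rightarrow> real \<Rightarrow> real \<Rightarrow> real \<Rightarrow> real \<Rightarrow> bool" where
  "cond_I0 f k g a b c \<rho> \<longleftrightarrow> (\<exists>\<epsilon>>0.
     (INF p\<in>{a..b} \<times> ({c * (\<rho> - \<epsilon>)..\<rho> / c + \<epsilon>} \<inter> {0..}). ereal (f (fst p) (snd p) / \<rho>))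
        > ereal (M_const k g a b))"

end

theory Submission
  imports Defs "HOL-Complex_Analysis.Great_Picard"
begin

text \<open>
  A self-map \<open>S\<close> of a compact convex set, with no continuity at all, has a point \<open>x\<close> lying in its
  closed-convex envelope at \<open>x\<close>: for a finite net \<open>d\<close>, Brouwer's theorem gives a convex combination
  \<open>x\<close> of net points that is close to a convex combination of values \<open>S (d i)\<close> with \<open>d i\<close> close to
  \<open>x\<close>, and a limit point of such \<open>x\<close> is as desired. The dimension of the simplex depends on the net,
  so Brouwer's theorem is needed for cubes of arbitrary dimension inside one type.

  Since \<open>S\<close> may jump, a map that is expanding near the inner and contracting near the outer
  boundary of an annulus of the cone can be extended by constants to a compact convex set without
  creating envelope fixed points outside the annulus. The opposite boundary behaviour is reduced to
  this one by conjugating with the inversion \<open>x \<mapsto> x / \<parallel>x\<parallel>\<^sup>2\<close>.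

  For the Hammerstein operator, \<open>(I\<^sup>1)\<close> gives contraction and \<open>(I\<^sup>0)\<close> gives expansion near the sphere
  of radius \<open>\<rho>\<close>, the latter already visible in the value at the point \<open>a\<close>. The hypothesis on the
  envelope turns the envelope fixed point into a fixed point of \<open>T\<close>.
\<close>

section \<open>Brouwer's theorem for cubes\<close>

lemma tendsto_fun_iff:
  fixes X :: "'a \<Rightarrow> 'i \<Rightarrow> 'b::topological_space"
  shows "(X \<longlongrightarrow> l) F \<longleftrightarrow> (\<forall>i. ((\<lambda>n. X n i) \<longlongrightarrow> l i) F)"
proof -
  have "(X \<longlongrightarrow> l) F \<longleftrightarrow> limitin (product_topology (\<lambda>i. euclidean) UNIV) X l F"
    by (simp add: euclidean_product_topology)
  then show ?thesis
    by (simp add: limitin_componentwise)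
qed

lemma compact_fun_box:
  fixes S :: "'i \<Rightarrow> 'b::topological_space set"
  assumes "\<And>i. compact (S i)"
  shows "compact {x. \<forall>i. x i \<in> S i}"
proof -
  have "compactin (product_topology (\<lambda>i. euclidean) UNIV) (PiE UNIV S)"
    using assms by (simp add: compactin_PiE)
  then show ?thesis
    by (simp add: euclidean_product_topology PiE_UNIV_domain Pi_def)
qed

text \<open>Cubes of all dimensions live in the one type of sequences, with the coordinates from
  \<open>n\<close> on frozen at 0, so that the dimension may depend on a net chosen inside a later
  proof. Kuhn's combinatorial lemma on grids of mesh \<open>1 / Suc m\<close> yields, for each
  coordinate, two nearby points at which \<open>F\<close> moves that coordinate in opposite
  directions. Compactness and continuity turn these signs into an equality.\<close>

lemma brouwer_cube:
  fixes F :: "(nat \<Rightarrow> real) \<Rightarrow> nat \<Rightarrow> real"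
  defines "Q n \<equiv> {x :: nat \<Rightarrow> real. \<forall>i. x i \<in> (if i < n then {0..1} else {0})}"
  assumes cont: "continuous_on (Q n) F" and maps: "F \<in> Q n \<rightarrow> Q n"
  obtains x where "x \<in> Q n" "F x = x"
proof -
  have grid: "\<exists>y r s. y \<in> Q n \<and> (\<forall>i<n. r i \<in> Q n \<and> s i \<in> Q n \<and>
      (\<forall>j. \<bar>r i j - y j\<bar> \<le> 1 / real (Suc m) \<and> \<bar>s i j - y j\<bar> \<le> 1 / real (Suc m)) \<and>
      r i i \<le> F (r i) i \<and> F (s i) i \<le> s i i)" for m
  proof -
    define p where "p = Suc m"
    define pt where "pt x = (\<lambda>i. if i < n then real (x i) / real p else 0)" for x :: "nat \<Rightarrow> nat"
    \<comment> \<open>Label 0 implies that \<open>F\<close> does not decrease coordinate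
      \<open>i\<close>. The clause \<open>x i < p\<close> forces label 1 on the upper face, as
      Kuhn's lemma demands; the coordinate is 1 there, so label 1 still implies that
      \<open>F\<close> does not increase it.\<close>
    define label where "label x i = (if x i < p \<and> pt x i \<le> F (pt x) i then 0 else 1::nat)" for x i
    have l01: "label x i = 0 \<or> label x i = 1" for x i by (simp add: label_def)
    have p: "p > 0" by (simp add: p_def)
    have ptQ: "pt x \<in> Q n" if "\<forall>i<n. x i \<le> p" for x
      using that p by (auto simp: Q_def pt_def)
    have FQ: "F (pt x) i \<in> {0..1}" if "\<forall>i<n. x i \<le> p" "i < n" for x i
    proof -
      have "F (pt x) \<in> Q n" using maps ptQ[OF that(1)] by blast
      then have "F (pt x) i \<in> (if i < n then {0..1} else {0})" by (simp only: Q_def mem_Collect_eq)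
      then show ?thesis using that(2) by simp
    qed
    have l0: "label x i = 0" if "\<forall>i<n. x i \<le> p" "i < n" "x i = 0" for x i
      using FQ[OF that(1,2)] that p by (simp add: label_def pt_def)
    obtain q where q: "\<forall>i<n. q i < p"
      and rs: "\<forall>i<n. \<exists>r s. (\<forall>j<n. q j \<le> r j \<and> r j \<le> q j + 1) \<and>
        (\<forall>j<n. q j \<le> s j \<and> s j \<le> q j + 1) \<and> label r i \<noteq> label s i"
      by (rule kuhn_lemma[OF p, of n label]) (use l0 in \<open>auto simp: label_def\<close>)
    have near: "\<bar>pt z j - pt q j\<bar> \<le> 1 / real (Suc m)" if "\<forall>j<n. q j \<le> z j \<and> z j \<le> q j + 1" for z j
    proof (cases "j < n")
      case True
      then have "\<bar>real (z j) - real (q j)\<bar> \<le> 1" using that by force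
      then show ?thesis using True
        by (simp add: pt_def p_def flip: diff_divide_distrib) (simp add: divide_right_mono)
    qed (simp add: pt_def)
    have "\<exists>r s. r \<in> Q n \<and> s \<in> Q n \<and>
      (\<forall>j. \<bar>r j - pt q j\<bar> \<le> 1 / real (Suc m) \<and> \<bar>s j - pt q j\<bar> \<le> 1 / real (Suc m)) \<and>
      r i \<le> F r i \<and> F s i \<le> s i" if i: "i < n" for i
    proof -
      obtain r s where r: "\<forall>j<n. q j \<le> r j \<and> r j \<le> q j + 1"
        and s: "\<forall>j<n. q j \<le> s j \<and> s j \<le> q j + 1" and l: "label r i \<noteq> label s i"
        using rs i by blast
      \<comment> \<open>Kuhn's lemma provides two different labels in no fixed order; the points are
        swapped if necessary so that \<open>r\<close> carries label 0.\<close>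
      have *: "\<exists>r s. (\<forall>j<n. q j \<le> r j \<and> r j \<le> q j + 1) \<and>
        (\<forall>j<n. q j \<le> s j \<and> s j \<le> q j + 1) \<and> label r i = 0 \<and> label s i = 1"
      proof (cases "label r i = 0")
        case True
        then have "label s i = 1" using l01[of s i] l by argo
        then show ?thesis using True r s by blast
      next
        case False
        then have "label r i = 1" "label s i = 0" using l01[of r i] l01[of s i] l by argo+
        then show ?thesis using r s by blast
      qed
      then obtain r s where r: "\<forall>j<n. q j \<le> r j \<and> r j \<le> q j + 1"
        and s: "\<forall>j<n. q j \<le> s j \<and> s j \<le> q j + 1" and lr: "label r i = 0" and ls: "label s i = 1"
        by blast
      have rp: "\<forall>j<n. r j \<le> p" and sp: "\<forall>j<n. s j \<le> p"
        using r s q by (metis Suc_eq_plus1 Suc_leI le_trans)+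
      have "pt r i \<le> F (pt r) i" using lr by (simp add: label_def split: if_splits)
      moreover have "F (pt s) i \<le> pt s i"
      proof (cases "s i < p")
        case True
        then show ?thesis using ls by (simp add: label_def split: if_splits)
      next
        case False
        then have "s i = p" using sp i by (meson le_neq_implies_less)
        then show ?thesis using FQ[OF sp i] i p by (simp add: pt_def)
      qed
      ultimately show ?thesis
        using ptQ[OF rp] ptQ[OF sp] near[OF r] near[OF s] by blast
    qed
    then obtain r s where "\<forall>i<n. r i \<in> Q n \<and> s i \<in> Q n \<and>
      (\<forall>j. \<bar>r i j - pt q j\<bar> \<le> 1 / real (Suc m) \<and> \<bar>s i j - pt q j\<bar> \<le> 1 / real (Suc m)) \<and>
      r i i \<le> F (r i) i \<and> F (s i) i \<le> s i i" by metis
    moreover have "pt q \<in> Q n" using q by (intro ptQ) (simp add: less_imp_le)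
    ultimately show ?thesis by blast
  qed
  obtain Y R S where Y: "\<And>m. Y m \<in> Q n"
    and RS: "\<And>m i. i < n \<Longrightarrow> R m i \<in> Q n \<and> S m i \<in> Q n"
    and R1: "\<And>m i j. i < n \<Longrightarrow> \<bar>R m i j - Y m j\<bar> \<le> 1 / real (Suc m)"
    and S1: "\<And>m i j. i < n \<Longrightarrow> \<bar>S m i j - Y m j\<bar> \<le> 1 / real (Suc m)"
    and RF: "\<And>m i. i < n \<Longrightarrow> R m i i \<le> F (R m i) i"
    and SF: "\<And>m i. i < n \<Longrightarrow> F (S m i) i \<le> S m i i"
    using grid by metis
  have "compact (Q n)"
    unfolding Q_def by (rule compact_fun_box) auto
  then have "seq_compact (Q n)" by (simp add: compact_eq_seq_compact_metric)
  then obtain x \<phi> where x: "x \<in> Q n" and \<phi>: "strict_mono \<phi>" and lim: "(Y \<circ> \<phi>) \<longlonglongrightarrow> x"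
    using Y by (metis seq_compactE)
  have inv: "(\<lambda>m. 1 / real (Suc (\<phi> m))) \<longlonglongrightarrow> 0"
    using LIMSEQ_subseq_LIMSEQ[OF LIMSEQ_inverse_real_of_nat \<phi>]
    by (simp add: o_def inverse_eq_divide)
  have near: "(\<lambda>m. Z (\<phi> m)) \<longlonglongrightarrow> x"
    if "\<And>m j. \<bar>Z m j - Y m j\<bar> \<le> 1 / real (Suc m)" for Z
    unfolding tendsto_fun_iff
  proof
    fix j
    have "(\<lambda>m. Z (\<phi> m) j - Y (\<phi> m) j) \<longlonglongrightarrow> 0"
      by (rule tendsto_rabs_zero_cancel, rule tendsto_sandwich[OF _ _ tendsto_const inv])
        (use that in auto)
    moreover have "(\<lambda>m. Y (\<phi> m) j) \<longlonglongrightarrow> x j"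
      using lim by (simp add: tendsto_fun_iff o_def)
    ultimately show "(\<lambda>m. Z (\<phi> m) j) \<longlonglongrightarrow> x j"
      using tendsto_add by fastforce
  qed
  have Flim: "(\<lambda>m. F (Z (\<phi> m)) i) \<longlonglongrightarrow> F x i"
    if "\<And>m. Z m \<in> Q n" "(\<lambda>m. Z (\<phi> m)) \<longlonglongrightarrow> x" for Z i
    using continuous_on_tendsto_compose[OF cont that(2) x] that(1) by (simp add: tendsto_fun_iff)
  have "F x i = x i" for i
  proof (cases "i < n")
    case True
    \<comment> \<open>Both sequences stay within the mesh of \<open>Y\<close> and so share its
      limit; the two sign conditions become the two inequalities between \<open>x i\<close> and
      \<open>F x i\<close>.\<close>
    have R: "(\<lambda>m. R (\<phi> m) i) \<longlonglongrightarrow> x" and S: "(\<lambda>m. S (\<phi> m) i) \<longlonglongrightarrow> x"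
      by (rule near, use R1 S1 True in blast)+
    have Ri: "(\<lambda>m. R (\<phi> m) i i) \<longlonglongrightarrow> x i" and Si: "(\<lambda>m. S (\<phi> m) i i) \<longlonglongrightarrow> x i"
      using R S by (auto simp: tendsto_fun_iff)
    have "x i \<le> F x i"
      by (rule LIMSEQ_le[OF Ri Flim[of "\<lambda>m. R m i"]]) (use R RS RF True in auto)
    moreover have "F x i \<le> x i"
      by (rule LIMSEQ_le[OF Flim[of "\<lambda>m. S m i"] Si]) (use S RS SF True in auto)
    ultimately show ?thesis by simp
  next
    case False
    have "y i = 0" if "y \<in> Q n" for y
      using that False by (metis (lifting) Q_def mem_Collect_eq singletonD)
    then show ?thesis using maps x by (metis funcset_mem)
  qed
  then show ?thesis using that x by blast
qed

section \<open>Envelope fixed points of arbitrary maps\<close>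

text \<open>Only the values of \<open>S\<close> at the finitely many points of an
  \<open>e\<close>-net enter. Each value \<open>S (d i)\<close> is replaced by a net point
  \<open>d (\<sigma> i)\<close> closer than \<open>e\<close>, and a partition of unity interpolates
  these replacements to a continuous self-map of a cube of weights. At a fixed weight vector,
  \<open>u p\<close> is a combination of the \<open>d (\<sigma> i)\<close>, and the same combination
  of the \<open>S (d i)\<close> is within \<open>e\<close> of it.\<close>

lemma approximate_fixed_point_arbitrary_map:
  fixes S :: "'a::real_normed_vector \<Rightarrow> 'a"
  assumes C: "compact C" "convex C" "C \<noteq> {}" and S: "S \<in> C \<rightarrow> C" and e: "e > 0"
  obtains x z where "x \<in> C" "z \<in> convex hull (S ` (cball x e \<inter> C))" "dist x z \<le> e"
proof -
  obtain D where D: "finite D" "D \<subseteq> C" "C \<subseteq> (\<Union>d\<in>D. ball d e)"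
    using compactE_image[OF C(1), of C "\<lambda>d. ball d e"] e
    by (metis UN_I centre_in_ball open_ball subsetI)
  obtain N :: nat and d where "D = d ` {i. i < N}"
    using finite_imp_nat_seg_image_inj_on[OF D(1)] by metis
  then have DN: "D = d ` {..<N}" by (simp add: lessThan_def)
  have dC: "d i \<in> C" if "i < N" for i using DN D(2) that by auto
  have "\<exists>j<N. dist (S (d i)) (d j) < e" if "i < N" for i
    using S dC[OF that] D(3) by (force simp: DN dist_commute)
  then obtain \<sigma> where \<sigma>: "\<And>i. i < N \<Longrightarrow> \<sigma> i < N \<and> dist (S (d i)) (d (\<sigma> i)) < e" by metis
  obtain x0 where x0: "x0 \<in> C" using C(3) by blast
  define Q where "Q = {x :: nat \<Rightarrow> real. \<forall>i. x i \<in> (if i < N then {0..1} else {0})}"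
  have Q0: "0 \<le> p i" if "p \<in> Q" for p i
    using that by (auto simp: Q_def split: if_splits dest!: spec[of _ i])
  define s where "s p = max 1 (\<Sum>i<N. p i)" for p :: "nat \<Rightarrow> real"
  \<comment> \<open>Equals \<open>\<Sum>i<N. p i *\<^sub>R d i\<close> on the simplex and takes values in \<open>C\<close> on the whole cube.\<close>
  define u where "u p = x0 + (\<Sum>i<N. (p i / s p) *\<^sub>R (d i - x0))" for p
  have s1: "1 \<le> s p" for p by (simp add: s_def)
  have uC: "u p \<in> C" if p: "p \<in> Q" for p
  proof -
    have le: "(\<Sum>i<N. p i / s p) \<le> 1"
      using s1[of p] by (simp add: s_def flip: sum_divide_distrib)
    \<comment> \<open>Index \<open>N\<close> carries the weight missing from 1 and is attached to
      \<open>x0\<close>, which exhibits \<open>u p\<close> as a convex combination of points of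
      \<open>C\<close>.\<close>
    define w where "w i = (if i < N then p i / s p else 1 - (\<Sum>i<N. p i / s p))" for i
    have "(\<Sum>i\<in>{..N}. w i *\<^sub>R (if i < N then d i else x0)) \<in> C"
    proof (rule convex_sum[OF _ C(2)])
      show "sum w {..N} = 1" by (simp add: w_def lessThan_Suc_atMost[symmetric])
      show "0 \<le> w i" if "i \<in> {..N}" for i
        using Q0[OF p, of i] le s1[of p] by (simp add: w_def)
    qed (use dC x0 in auto)
    also have "(\<Sum>i\<in>{..N}. w i *\<^sub>R (if i < N then d i else x0)) = u p"
      by (simp add: w_def u_def lessThan_Suc_atMost[symmetric] scaleR_diff_right scaleR_diff_left
          sum_subtractf scaleR_sum_left)
    finally show ?thesis .
  qed
  \<comment> \<open>Bump functions, positive exactly when \<open>d i\<close> is closer than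
    \<open>e\<close> to \<open>u p\<close>. Their sum \<open>B p\<close> is positive because the net
    covers \<open>C\<close>, so the quotients form a partition of unity.\<close>
  define \<beta> where "\<beta> p i = max 0 (e - dist (u p) (d i))" for p i
  define B where "B p = (\<Sum>i<N. \<beta> p i)" for p
  \<comment> \<open>The weight of \<open>d i\<close> is moved to the index of the net point
    approximating \<open>S (d i)\<close>, so combinations with weights \<open>F p\<close> are
    combinations of the points \<open>d (\<sigma> i)\<close>.\<close>
  define F where "F p = (\<lambda>j. \<Sum>i | i < N \<and> \<sigma> i = j. \<beta> p i / B p)" for p
  have \<beta>0: "0 \<le> \<beta> p i" for p i by (simp add: \<beta>_def)
  have B0: "B p > 0" if p: "p \<in> Q" for p
  proof -
    obtain i where "i < N" "dist (u p) (d i) < e"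
      using uC[OF p] D(3) by (force simp: DN dist_commute)
    then have "0 < \<beta> p i" by (simp add: \<beta>_def)
    moreover have "\<beta> p i \<le> B p"
      unfolding B_def using \<open>i < N\<close> \<beta>0 by (intro member_le_sum) auto
    ultimately show ?thesis by linarith
  qed
  have sumF: "(\<Sum>j<N. F p j *\<^sub>R h j) = (\<Sum>i<N. (\<beta> p i / B p) *\<^sub>R h (\<sigma> i))"
    for p and h :: "nat \<Rightarrow> 'b::real_vector"
  proof -
    have "(\<Sum>j<N. F p j *\<^sub>R h j) =
        (\<Sum>j<N. \<Sum>i | i \<in> {..<N} \<and> \<sigma> i = j. (\<beta> p i / B p) *\<^sub>R h (\<sigma> i))"
      unfolding F_def scaleR_sum_left by (intro sum.cong) auto
    also have "\<dots> = (\<Sum>i<N. (\<beta> p i / B p) *\<^sub>R h (\<sigma> i))"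
      by (rule sum.group) (use \<sigma> in auto)
    finally show ?thesis .
  qed
  have sum1: "(\<Sum>i<N. \<beta> p i / B p) = 1" if "p \<in> Q" for p
    using B0[OF that] by (simp add: B_def flip: sum_divide_distrib)
  have sumF1: "(\<Sum>j<N. F p j) = 1" if "p \<in> Q" for p
    using sumF[of p "\<lambda>_. 1::real"] sum1[OF that] by simp
  have F0: "0 \<le> F p j" if "p \<in> Q" for p j
    unfolding F_def by (intro sum_nonneg divide_nonneg_nonneg \<beta>0 less_imp_le[OF B0[OF that]])
  have FQ: "F \<in> Q \<rightarrow> Q"
  proof
    fix p assume p: "p \<in> Q"
    have "F p j \<le> 1" if "j < N" for j
      using member_le_sum[of j "{..<N}" "F p"] F0[OF p] sumF1[OF p] that by auto
    moreover have "F p j = 0" if "\<not> j < N" for j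
    proof -
      have "{i. i < N \<and> \<sigma> i = j} = {}" using \<sigma> that by auto
      then show ?thesis unfolding F_def by (metis sum.empty)
    qed
    ultimately show "F p \<in> Q" using F0[OF p] by (simp add: Q_def)
  qed
  have coord: "continuous_on Q (\<lambda>p. p i)" for i
    by (rule continuous_on_subset[OF continuous_on_product_coordinates]) simp
  have "continuous_on Q s"
    unfolding s_def by (intro continuous_intros coord)
  then have "continuous_on Q u"
    unfolding u_def by (intro continuous_intros coord) (use s1 in \<open>metis not_one_le_zero\<close>)+
  then have cont\<beta>: "continuous_on Q (\<lambda>p. \<beta> p i)" for i
    unfolding \<beta>_def by (intro continuous_intros)
  have contF: "continuous_on Q F"
    unfolding F_def B_def using B0
    by (intro continuous_on_coordinatewise_then_product continuous_intros cont\<beta>)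
      (metis B_def less_irrefl)
  obtain p where p: "p \<in> Q" and fp: "F p = p"
    using brouwer_cube[of N F] contF FQ unfolding Q_def by blast
  \<comment> \<open>Values of \<open>F\<close> have coordinate sum 1, so the fixed point lies on the
    simplex, where \<open>s p = 1\<close> and the base point \<open>x0\<close> cancels from
    \<open>u p\<close>.\<close>
  have sp: "(\<Sum>i<N. p i) = 1" using sumF1[OF p] fp by simp
  have "u p = (\<Sum>i<N. p i *\<^sub>R d i)"
    using sp by (simp add: u_def s_def scaleR_diff_right sum_subtractf flip: scaleR_sum_left)
  also have "\<dots> = (\<Sum>i<N. (\<beta> p i / B p) *\<^sub>R d (\<sigma> i))"
    using sumF[of p d] fp by simp
  finally have up: "u p = (\<Sum>i<N. (\<beta> p i / B p) *\<^sub>R d (\<sigma> i))" .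
  define z where "z = (\<Sum>i<N. (\<beta> p i / B p) *\<^sub>R S (d i))"
  \<comment> \<open>Dropping the indices of weight 0 leaves only net points in the ball of radius
    \<open>e\<close> about \<open>u p\<close>.\<close>
  define I where "I = {i. i < N \<and> \<beta> p i \<noteq> 0}"
  have zI: "z = (\<Sum>i\<in>I. (\<beta> p i / B p) *\<^sub>R S (d i))"
    unfolding z_def by (intro sum.mono_neutral_right) (auto simp: I_def)
  have I1: "(\<Sum>i\<in>I. \<beta> p i / B p) = 1"
    unfolding sum1[OF p, symmetric] by (intro sum.mono_neutral_left) (auto simp: I_def)
  have "z \<in> convex hull (S ` (cball (u p) e \<inter> C))"
    unfolding zI
  proof (rule convex_sum)
    show "S (d i) \<in> convex hull (S ` (cball (u p) e \<inter> C))" if "i \<in> I" for i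
      using that dC[of i] by (intro hull_inc imageI) (auto simp: I_def \<beta>_def max_def split: if_splits)
  qed (use I1 \<beta>0 B0[OF p] in \<open>auto simp: I_def intro: less_imp_le\<close>)
  moreover have "dist (u p) z \<le> e"
  proof -
    have "norm (u p - z) \<le> (\<Sum>i<N. norm ((\<beta> p i / B p) *\<^sub>R (d (\<sigma> i) - S (d i))))"
      unfolding up z_def by (simp add: norm_sum scaleR_diff_right flip: sum_subtractf)
    also have "\<dots> \<le> (\<Sum>i<N. (\<beta> p i / B p) * e)"
    proof (rule sum_mono)
      fix i assume "i \<in> {..<N}"
      then have "norm (d (\<sigma> i) - S (d i)) \<le> e"
        using \<sigma>[of i] by (simp add: dist_norm norm_minus_commute)
      moreover have "0 \<le> \<beta> p i / B p" using \<beta>0[of p i] B0[OF p] by simp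
      ultimately show "norm ((\<beta> p i / B p) *\<^sub>R (d (\<sigma> i) - S (d i))) \<le> \<beta> p i / B p * e"
        by (simp only: norm_scaleR abs_of_nonneg mult_left_mono)
    qed
    also have "\<dots> = e" using sum1[OF p] by (simp only: sum_distrib_right[symmetric] mult_1)
    finally show ?thesis by (simp add: dist_norm)
  qed
  ultimately show ?thesis using that uC[OF p] by blast
qed

text \<open>Approximate fixed points for radii \<open>1 / Suc n\<close> accumulate at some
  \<open>x\<close>. Far out in the subsequence their small balls lie inside any given ball about
  \<open>x\<close>, so the nearby points \<open>Z\<close> of the hulls belong to the hull for
  \<open>x\<close> and converge to \<open>x\<close>.\<close>

lemma fixed_point_closed_convex_envelope:
  fixes S :: "'a::real_normed_vector \<Rightarrow> 'a"
  assumes C: "compact C" "convex C" "C \<noteq> {}" and S: "S \<in> C \<rightarrow> C"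
  obtains x where "x \<in> C" "\<And>e. e > 0 \<Longrightarrow> x \<in> closure (convex hull (S ` (cball x e \<inter> C)))"
proof -
  have "\<exists>x z. x \<in> C \<and> z \<in> convex hull (S ` (cball x (1 / Suc n) \<inter> C)) \<and> dist x z \<le> 1 / Suc n" for n
    by (rule approximate_fixed_point_arbitrary_map[OF C S, of "1 / Suc n"]) auto
  then obtain X Z where X: "\<And>n. X n \<in> C"
    and Z: "\<And>n. Z n \<in> convex hull (S ` (cball (X n) (1 / Suc n) \<inter> C))"
    and XZ: "\<And>n. dist (X n) (Z n) \<le> 1 / Suc n" by metis
  from C(1) have "seq_compact C" by (simp add: compact_eq_seq_compact_metric)
  then obtain x \<phi> where x: "x \<in> C" and \<phi>: "strict_mono \<phi>" and lim: "(X \<circ> \<phi>) \<longlonglongrightarrow> x"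
    using X by (metis seq_compactE)
  have inv: "(\<lambda>m. 1 / real (Suc (\<phi> m))) \<longlonglongrightarrow> 0"
    using LIMSEQ_subseq_LIMSEQ[OF LIMSEQ_inverse_real_of_nat \<phi>]
    by (simp add: o_def inverse_eq_divide)
  show ?thesis
  proof (rule that[OF x])
    fix e :: real assume e: "e > 0"
    show "x \<in> closure (convex hull (S ` (cball x e \<inter> C)))"
      unfolding closure_approachable
    proof (intro allI impI)
      fix \<eta> :: real assume \<eta>: "\<eta> > 0"
      \<comment> \<open>Two errors, the radius \<open>1 / Suc n\<close> and the distance to the
        limit, are added twice: once against \<open>e\<close> and once against \<eta>.\<close>
      define \<delta> where "\<delta> = min e \<eta> / 2"
      have "\<delta> > 0" using e \<eta> by (simp add: \<delta>_def)
      then have "\<forall>\<^sub>F m in sequentially. 1 / real (Suc (\<phi> m)) < \<delta> \<and> dist (X (\<phi> m)) x < \<delta>"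
        using order_tendstoD(2)[OF inv, of \<delta>] tendstoD[OF lim, of \<delta>]
        by (auto simp: o_def elim: eventually_elim2)
      then obtain m where m: "1 / real (Suc (\<phi> m)) < \<delta>" "dist (X (\<phi> m)) x < \<delta>"
        by (auto simp: eventually_sequentially)
      have "cball (X (\<phi> m)) (1 / Suc (\<phi> m)) \<subseteq> cball x e"
      proof
        fix t assume "t \<in> cball (X (\<phi> m)) (1 / Suc (\<phi> m))"
        then have "dist (X (\<phi> m)) t \<le> 1 / Suc (\<phi> m)" by simp
        then have "dist x t \<le> \<delta> + \<delta>"
          using dist_triangle[of x t "X (\<phi> m)"] m unfolding dist_commute[of x "X (\<phi> m)"] by linarith
        also have "\<dots> \<le> e" by (simp add: \<delta>_def)
        finally show "t \<in> cball x e" by simp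
      qed
      then have "S ` (cball (X (\<phi> m)) (1 / Suc (\<phi> m)) \<inter> C) \<subseteq> S ` (cball x e \<inter> C)"
        by (intro image_mono Int_mono) simp_all
      then have "Z (\<phi> m) \<in> convex hull (S ` (cball x e \<inter> C))"
        using Z[of "\<phi> m"] by (rule subsetD[OF hull_mono])
      moreover have "dist (Z (\<phi> m)) x < \<eta>"
      proof -
        have "dist (Z (\<phi> m)) x \<le> dist (X (\<phi> m)) (Z (\<phi> m)) + dist (X (\<phi> m)) x"
          by (rule dist_triangle3)
        also have "\<dots> < \<delta> + \<delta>" using XZ[of "\<phi> m"] m by linarith
        also have "\<dots> \<le> \<eta>" by (simp add: \<delta>_def)
        finally show ?thesis .
      qed
      ultimately show "\<exists>y\<in>convex hull (S ` (cball x e \<inter> C)). dist y x < \<eta>" by blast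
    qed
  qed
qed

section \<open>Compression and expansion of a cone\<close>

text \<open>Conditions on values pass to the envelope only when they define closed convex sets. A
  lower bound on the norm does not, so expansion is expressed by a linear functional
  \<open>l\<close> below the norm, whose superlevel set is a half-space; contraction is membership
  in a ball. An envelope fixed point near or beyond either sphere would lie in the wrong one of
  these sets.\<close>

lemma cone_compression_envelope:
  fixes S :: "'a::real_normed_vector \<Rightarrow> 'a" and l :: "'a \<Rightarrow> real"
  defines "A P r R \<equiv> {x \<in> P. r \<le> norm x \<and> norm x \<le> R}"
  assumes C: "compact C" "convex C" "0 \<in> C" "C \<subseteq> P"
    and l: "bounded_linear l" "\<And>x. l x \<le> norm x"
    and r: "r < R" and e: "0 < e" "e \<le> R"
    and S: "S \<in> A P r R \<rightarrow> C"
    and low: "\<And>x. x \<in> P \<Longrightarrow> r \<le> norm x \<Longrightarrow> norm x \<le> r + e \<Longrightarrow> r + e \<le> l (S x)"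
    and high: "\<And>x. x \<in> P \<Longrightarrow> R - e \<le> norm x \<Longrightarrow> norm x \<le> R \<Longrightarrow> norm (S x) \<le> R - e"
    and v0: "v0 \<in> P" "norm v0 = r"
  obtains x where "x \<in> A P r R"
    "\<And>d. d > 0 \<Longrightarrow> x \<in> closure (convex hull (S ` (cball x d \<inter> A P r R)))"
proof -
  \<comment> \<open>No continuity is needed, so \<open>S\<close> may be extended by constants across the two spheres.\<close>
  define S' where "S' x = (if norm x < r then S v0 else if norm x \<le> R then S x else 0)" for x
  have "S' x \<in> C" if "x \<in> C" for x
    using S C(3,4) v0 r that by (force simp: S'_def A_def Pi_iff)
  then have "S' \<in> C \<rightarrow> C" by blast
  then obtain x where x: "x \<in> C"
    and env: "\<And>d. d > 0 \<Longrightarrow> x \<in> closure (convex hull (S' ` (cball x d \<inter> C)))"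
    using fixed_point_closed_convex_envelope[OF C(1,2)] C(3) by (metis empty_iff)
  \<comment> \<open>A closed convex set that contains the values of \<open>S'\<close> near
    \<open>x\<close> contains \<open>x\<close>.\<close>
  have envH: "x \<in> H" if "closed H" "convex H" "d > 0" "\<And>v. v \<in> C \<Longrightarrow> dist x v \<le> d \<Longrightarrow> S' v \<in> H" for H d
  proof -
    have "convex hull (S' ` (cball x d \<inter> C)) \<subseteq> H"
      by (intro hull_minimal) (use that in auto)
    then show ?thesis using env[OF that(3)] closure_minimal[OF _ that(1)] by blast
  qed
  have near: "\<bar>norm v - norm x\<bar> \<le> d" if "dist x v \<le> d" for v d
    using that norm_triangle_ineq3[of v x] by (simp add: dist_norm norm_minus_commute)
  \<comment> \<open>If \<open>x\<close> is within \<open>d\<close> of a sphere, points within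
    \<open>d\<close> of \<open>x\<close> are within \<open>2 * d\<close> of it on the annulus side:
    they stay in the shell controlled by \<open>low\<close> or \<open>high\<close> and do not reach
    the other sphere. Once \<open>x\<close> keeps distance \<open>d\<close> from both spheres, its
    \<open>d\<close>-ball in the cone stays in the annulus, where \<open>S'\<close> agrees with
    \<open>S\<close>.\<close>
  define d where "d = min e (R - r) / 4"
  have d: "d > 0" "2 * d < e" "2 * d < R - r" using e r by (auto simp: d_def min_def)
  have lo: "r + d \<le> norm x"
  proof (rule ccontr)
    assume "\<not> r + d \<le> norm x"
    then have nx: "norm x < r + d" by simp
    have "x \<in> {y. r + e \<le> l y}"
    proof (rule envH)
      show "closed {y. r + e \<le> l y}"
        by (intro closed_Collect_le continuous_intros bounded_linear.continuous_on[OF l(1)])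
      show "convex {y. r + e \<le> l y}"
      proof -
        have "convex {y. l y \<in> {r + e..}}"
          using convex_linear_vimage[OF bounded_linear.linear[OF l(1)] convex_real_interval(1)]
          by (simp add: vimage_def)
        then show ?thesis by simp
      qed
      fix v assume v: "v \<in> C" "dist x v \<le> d"
      then have nv: "norm v < r + 2 * d" using near[OF v(2)] nx by linarith
      show "S' v \<in> {y. r + e \<le> l y}"
        using low[OF v0(1)] low[of v] nv v0(2) v C(4) e d by (auto simp: S'_def)
    qed (fact d)
    then show False using l(2)[of x] nx d e by simp
  qed
  have hi: "norm x \<le> R - d"
  proof (rule ccontr)
    assume "\<not> norm x \<le> R - d"
    then have nx: "norm x > R - d" by simp
    have "x \<in> cball 0 (R - e)"
    proof (rule envH)
      fix v assume v: "v \<in> C" "dist x v \<le> d"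
      then have nv: "norm v > R - 2 * d" using near[OF v(2)] nx by linarith
      have "norm (S' v) \<le> R - e \<or> R < norm v"
        using high[of v] nv v C(4) e d by (auto simp: S'_def)
      then show "S' v \<in> cball 0 (R - e)"
        using d nv e(2) by (auto simp: S'_def)
    qed (use d in auto)
    then show False using nx d e by simp
  qed
  show ?thesis
  proof (rule that)
    show xA: "x \<in> A P r R" using x C(4) lo hi d by (auto simp: A_def)
    fix h :: real assume h: "h > 0"
    have sub: "S' ` (cball x (min h d) \<inter> C) \<subseteq> S ` (cball x h \<inter> A P r R)"
    proof
      fix y assume "y \<in> S' ` (cball x (min h d) \<inter> C)"
      then obtain v where v: "v \<in> C" "dist x v \<le> h" "dist x v \<le> d" "y = S' v" by auto
      have "v \<in> A P r R" using near[OF v(3)] lo hi v(1) C(4) by (auto simp: A_def)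
      then show "y \<in> S ` (cball x h \<inter> A P r R)"
        using v by (auto simp: S'_def A_def)
    qed
    show "x \<in> closure (convex hull (S ` (cball x h \<inter> A P r R)))"
      using env[of "min h d"] h d closure_mono[OF hull_mono[OF sub]] by auto
  qed
qed


text \<open>For \<open>S x = (norm x)\<^sup>2 *\<^sub>R T (J x)\<close>, the equation
  \<open>S x = x\<close> with nonzero \<open>x\<close> says \<open>T (J x) = J x\<close>. Inversion
  exchanges the spheres, so \<open>S\<close> expands near radius \<open>1 / R\<close> and contracts
  near radius \<open>1 / r\<close>. Envelopes are carried back as well, since the scalar factor is
  continuous and the values of \<open>T\<close> are bounded.\<close>

lemma cone_expansion_envelope:
  fixes T :: "'a::real_normed_vector \<Rightarrow> 'a" and l :: "'a \<Rightarrow> real"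
  defines "A P r R \<equiv> {x \<in> P. r \<le> norm x \<and> norm x \<le> R}"
  assumes C: "compact C" "convex C" "0 \<in> C" "C \<subseteq> P"
    and cone: "\<And>x t. x \<in> P \<Longrightarrow> 0 \<le> t \<Longrightarrow> t *\<^sub>R x \<in> P"
    and l: "bounded_linear l" "\<And>x. l x \<le> norm x"
    and r: "0 < r" "r < R" and e: "0 < e" "e \<le> r"
    and T: "T \<in> A P r R \<rightarrow> C"
    and low: "\<And>x. x \<in> P \<Longrightarrow> r \<le> norm x \<Longrightarrow> norm x \<le> r + e \<Longrightarrow> norm (T x) \<le> r - e"
    and high: "\<And>x. x \<in> P \<Longrightarrow> R - e \<le> norm x \<Longrightarrow> norm x \<le> R \<Longrightarrow> R + e \<le> l (T x)"
    and v0: "v0 \<in> P" "norm v0 = R"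
  obtains x where "x \<in> A P r R"
    "\<And>d. d > 0 \<Longrightarrow> x \<in> closure (convex hull (T ` (cball x d \<inter> A P r R)))"
proof -
  \<comment> \<open>Conjugation with the inversion in the unit sphere turns expansion into compression.\<close>
  define J where "J x = (1 / (norm x)\<^sup>2) *\<^sub>R x" for x :: 'a
  define S where "S x = (norm x)\<^sup>2 *\<^sub>R T (J x)" for x
  \<comment> \<open>One margin for three purposes: \<open>e / R\<^sup>2\<close> and
    \<open>e / r\<^sup>2\<close> are the rescaled gains at the two spheres, and
    \<open>e / (r * (r + e))\<close> is \<open>1 / r - 1 / (r + e)\<close>, the width of the
    inverted inner shell. The factor 2 covers \<open>r * (r + e)\<close>, which is at most
    \<open>2 * r\<^sup>2\<close> because \<open>e \<le> r\<close>.\<close>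
  define e' where "e' = e / (2 * R\<^sup>2)"
  have R0: "R > 0" using r by simp
  have e': "e' > 0" "e' \<le> e / R\<^sup>2" "e' \<le> e / r\<^sup>2" "e' \<le> e / (r * (r + e))"
  proof -
    have le: "r\<^sup>2 \<le> R\<^sup>2" using r by (simp add: power_mono)
    have le2: "r\<^sup>2 \<le> 2 * R\<^sup>2" using le zero_le_power2[of R] by linarith
    have "r * (r + e) \<le> r * (2 * r)" using r e by (intro mult_left_mono) auto
    then have "r * (r + e) \<le> 2 * R\<^sup>2" using le by (simp add: power2_eq_square)
    then show "e' \<le> e / (r * (r + e))" unfolding e'_def using e r
      by (intro divide_left_mono mult_pos_pos) auto
    show "e' \<le> e / R\<^sup>2" "e' \<le> e / r\<^sup>2" unfolding e'_def using e r R0 le2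
      by (auto intro!: divide_left_mono)
    show "e' > 0" using e R0 by (simp add: e'_def)
  qed
  have normJ: "norm (J x) = 1 / norm x" for x
    by (simp add: J_def power2_eq_square)
  have JA: "J x \<in> A P r R" if "x \<in> A P (1 / R) (1 / r)" for x
  proof -
    have x: "x \<in> P" "1 / R \<le> norm x" "norm x \<le> 1 / r" using that by (auto simp: A_def)
    have "norm x > 0" using x(2) R0 by (meson less_le_trans zero_less_divide_1_iff)
    then have "r \<le> 1 / norm x" "1 / norm x \<le> R" using x r by (auto simp: field_simps)
    moreover have "J x \<in> P" using cone[OF x(1)] by (simp add: J_def)
    ultimately show ?thesis by (simp add: A_def normJ)
  qed
  have nx: "norm x > 0" if "x \<in> A P (1 / R) (1 / r)" for x
    using that R0 unfolding A_def by (metis (lifting) mem_Collect_eq less_le_trans zero_less_divide_1_iff)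
  \<comment> \<open>The factor in \<open>S\<close> is at most \<open>1 / r\<^sup>2\<close>. As
    \<open>C\<close> is convex and contains 0, it is closed under shrinking, so this dilate of
    \<open>C\<close> receives all values of \<open>S\<close>.\<close>
  let ?C = "(\<lambda>x. (1 / r\<^sup>2) *\<^sub>R x) ` C"
  obtain x where xA: "x \<in> A P (1 / R) (1 / r)"
    and env: "\<And>d. d > 0 \<Longrightarrow> x \<in> closure (convex hull (S ` (cball x d \<inter> A P (1 / R) (1 / r))))"
  proof (rule cone_compression_envelope[where S=S and C="?C" and P=P and r="1/R" and R="1/r" and e=e'
        and l=l and ?v0.0="J v0", folded A_def])
    show "compact ?C" using C(1) by (intro compact_continuous_image continuous_intros)
    show "convex ?C" using C(2) by (rule convex_scaling)
    show "0 \<in> ?C" using C(3) by force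
    show "?C \<subseteq> P" using C(4) cone by auto
    show "S \<in> A P (1 / R) (1 / r) \<rightarrow> ?C"
    proof
      fix x assume x: "x \<in> A P (1 / R) (1 / r)"
      have "norm x \<le> 1 / r" using x by (simp add: A_def)
      then have "(norm x)\<^sup>2 \<le> (1 / r)\<^sup>2" by (intro power_mono) auto
      then have t: "(norm x)\<^sup>2 * r\<^sup>2 \<le> 1" using r by (simp add: field_simps power_divide)
      have "T (J x) \<in> C" using T JA[OF x] by blast
      then have "((norm x)\<^sup>2 * r\<^sup>2) *\<^sub>R T (J x) + (1 - (norm x)\<^sup>2 * r\<^sup>2) *\<^sub>R 0 \<in> C"
        using C t by (intro convexD) auto
      then have "((norm x)\<^sup>2 * r\<^sup>2) *\<^sub>R T (J x) \<in> C" by simp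
      moreover have "S x = (1 / r\<^sup>2) *\<^sub>R (((norm x)\<^sup>2 * r\<^sup>2) *\<^sub>R T (J x))"
        using r by (simp add: S_def)
      ultimately show "S x \<in> ?C" by blast
    qed
    show "1 / R + e' \<le> l (S x)" if x: "x \<in> P" "1 / R \<le> norm x" "norm x \<le> 1 / R + e'" for x
    proof -
      have n0: "norm x > 0" using x R0 by (meson less_le_trans zero_less_divide_1_iff)
      have up: "1 / norm x \<le> R" using x n0 R0 by (simp add: field_simps)
      have "(R - e) * norm x \<le> 1"
      proof -
        have "norm x \<le> 1 / R + e / R\<^sup>2" using x e'(2) by linarith
        then have "(R - e) * norm x \<le> (R - e) * (1 / R + e / R\<^sup>2)" using e r by (intro mult_left_mono) auto
        also have "\<dots> = (R\<^sup>2 - e\<^sup>2) / R\<^sup>2" using R0 by (simp add: field_simps power2_eq_square)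
        also have "\<dots> \<le> 1" using R0 by (simp add: field_simps)
        finally show ?thesis .
      qed
      then have lo: "R - e \<le> 1 / norm x" using n0 by (simp add: field_simps)
      have "J x \<in> P" using cone[OF x(1)] by (simp add: J_def)
      then have hT: "R + e \<le> l (T (J x))" using high lo up by (simp add: normJ)
      have "(1 / R)\<^sup>2 \<le> (norm x)\<^sup>2" using x R0 by (intro power_mono) auto
      then have "(1 / R)\<^sup>2 * (R + e) \<le> (norm x)\<^sup>2 * l (T (J x))"
        using hT R0 e by (intro mult_mono) auto
      moreover have "(1 / R)\<^sup>2 * (R + e) = 1 / R + e / R\<^sup>2"
        using R0 by (simp add: field_simps power2_eq_square)
      moreover have "l (S x) = (norm x)\<^sup>2 * l (T (J x))"
        unfolding S_def using bounded_linear.linear[OF l(1)] by (simp add: linear_scale)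
      ultimately show ?thesis using e'(2) by linarith
    qed
    show "norm (S x) \<le> 1 / r - e'" if x: "x \<in> P" "1 / r - e' \<le> norm x" "norm x \<le> 1 / r" for x
    proof -
      have "e / (r * (r + e)) = 1 / r - 1 / (r + e)"
        using r e by (simp add: field_simps)
      then have lo: "1 / (r + e) \<le> norm x" using x(2) e'(4) by linarith
      then have n0: "norm x > 0" using r e by (meson add_pos_pos less_le_trans zero_less_divide_1_iff)
      have "1 / norm x \<le> r + e" "r \<le> 1 / norm x"
        using lo n0 r e x(3) by (auto simp: field_simps)
      moreover have "J x \<in> P" using cone[OF x(1)] by (simp add: J_def)
      ultimately have hT: "norm (T (J x)) \<le> r - e" using low by (simp add: normJ)
      have "(norm x)\<^sup>2 \<le> (1 / r)\<^sup>2" using x r by (intro power_mono) auto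
      then have "(norm x)\<^sup>2 * norm (T (J x)) \<le> (1 / r)\<^sup>2 * (r - e)"
        using hT by (intro mult_mono) auto
      also have "\<dots> = 1 / r - e / r\<^sup>2" using r by (simp add: field_simps power2_eq_square)
      also have "\<dots> \<le> 1 / r - e'" using e'(3) by simp
      finally show ?thesis by (simp add: S_def)
    qed
    show "1 / R < 1 / r" using r by (simp add: field_simps)
    have "e / r\<^sup>2 \<le> 1 / r" using r e by (simp add: field_simps power2_eq_square)
    then show "e' \<le> 1 / r" using e'(3) by linarith
    show "J v0 \<in> P" using cone v0 by (simp add: J_def)
    show "norm (J v0) = 1 / R" using v0 by (simp add: normJ)
  qed (use l e' in auto)
  have x0: "norm x > 0" using nx xA by blast
  show ?thesis
  proof (rule that)
    show "J x \<in> A P r R" using JA xA by blast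
    fix d :: real assume d: "d > 0"
    let ?H = "convex hull (T ` (cball (J x) d \<inter> A P r R))"
    show "J x \<in> closure ?H"
      unfolding closure_approachable
    proof (intro allI impI)
      fix \<eta> :: real assume \<eta>: "\<eta> > 0"
      obtain B where B: "B > 0" "\<And>y. y \<in> C \<Longrightarrow> norm y \<le> B"
        using compact_imp_bounded[OF C(1)] by (auto simp: bounded_pos)
      \<comment> \<open>The approximation error and the error from the varying factor add up to less
        than \<open>\<eta>' * (1 + B)\<close>, which is half of
        \<open>\<eta> * (norm x)\<^sup>2\<close>; the final division by
        \<open>(norm x)\<^sup>2\<close> then leaves less than \<eta>.\<close>
      define \<eta>' where "\<eta>' = \<eta> * (norm x)\<^sup>2 / (2 * (1 + B))"
      have \<eta>': "\<eta>' > 0" using \<eta> B x0 by (simp add: \<eta>'_def)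
      have "isCont J x" unfolding J_def using x0 by (intro continuous_intros) auto
      then obtain d1 where d1: "d1 > 0" "\<And>v. dist v x < d1 \<Longrightarrow> dist (J v) (J x) < d"
        using d unfolding continuous_at_eps_delta by (metis)
      have "isCont (\<lambda>v. (norm v)\<^sup>2) x" by (intro continuous_intros)
      then obtain d2 where d2: "d2 > 0" "\<And>v. dist v x < d2 \<Longrightarrow> dist ((norm v)\<^sup>2) ((norm x)\<^sup>2) < \<eta>'"
        using \<eta>' unfolding continuous_at_eps_delta by (metis)
      define d3 where "d3 = min d1 d2 / 2"
      have d3: "d3 > 0" "d3 < d1" "d3 < d2" using d1 d2 by (auto simp: d3_def min_def)
      \<comment> \<open>The scalar factor is frozen at \<open>(norm x)\<^sup>2\<close>, and a ball
        absorbs its variation. The sum remains convex, so it contains the hull of the nearby values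
        of \<open>S\<close>.\<close>
      let ?K = "\<Union>y\<in>(\<lambda>h. (norm x)\<^sup>2 *\<^sub>R h) ` ?H. \<Union>z\<in>cball 0 (\<eta>' * B). {y + z}"
      have "convex ?K"
        by (intro convex_sums convex_scaling convex_convex_hull convex_cball)
      moreover have "S ` (cball x d3 \<inter> A P (1 / R) (1 / r)) \<subseteq> ?K"
      proof
        fix y assume "y \<in> S ` (cball x d3 \<inter> A P (1 / R) (1 / r))"
        then obtain v where v: "v \<in> A P (1 / R) (1 / r)" "dist x v \<le> d3" "y = S v" by auto
        have JvA: "J v \<in> A P r R" using JA v(1) .
        have "dist v x < d1" "dist v x < d2" using v(2) d3 by (auto simp: dist_commute)
        then have near: "dist (J v) (J x) < d" "\<bar>(norm v)\<^sup>2 - (norm x)\<^sup>2\<bar> \<le> \<eta>'"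
          using d1(2) d2(2)[of v] by (auto simp: dist_real_def)
        have "T (J v) \<in> ?H"
          using JvA near(1) by (intro hull_inc imageI) (auto simp: dist_commute)
        moreover have "norm (((norm v)\<^sup>2 - (norm x)\<^sup>2) *\<^sub>R T (J v)) \<le> \<eta>' * B"
          using near(2) B(2)[of "T (J v)"] JvA T \<eta>' by (auto intro!: mult_mono)
        moreover have "y = (norm x)\<^sup>2 *\<^sub>R T (J v) + ((norm v)\<^sup>2 - (norm x)\<^sup>2) *\<^sub>R T (J v)"
          by (simp add: v(3) S_def algebra_simps)
        ultimately show "y \<in> ?K"
          by (intro UN_I[of "(norm x)\<^sup>2 *\<^sub>R T (J v)"] UN_I[of "((norm v)\<^sup>2 - (norm x)\<^sup>2) *\<^sub>R T (J v)"] imageI)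
            (simp_all only: mem_cball_0 singleton_iff)
      qed
      ultimately have sub: "convex hull (S ` (cball x d3 \<inter> A P (1 / R) (1 / r))) \<subseteq> ?K"
        by (intro hull_minimal)
      obtain y where "y \<in> convex hull (S ` (cball x d3 \<inter> A P (1 / R) (1 / r)))" "dist y x < \<eta>'"
        using env[OF d3(1)] \<eta>' unfolding closure_approachable by blast
      then obtain h z where h: "h \<in> ?H" and z: "norm z \<le> \<eta>' * B" and y: "norm ((norm x)\<^sup>2 *\<^sub>R h + z - x) < \<eta>'"
        using sub by (force simp: dist_norm)
      have "norm ((norm x)\<^sup>2 *\<^sub>R h - x) \<le> norm ((norm x)\<^sup>2 *\<^sub>R h + z - x) + norm z"
        by (metis (no_types, lifting) add_diff_cancel_left' diff_add_eq norm_triangle_ineq4 add.commute diff_diff_eq2)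
      also have "\<dots> < \<eta>' * (1 + B)" using y z by (simp add: algebra_simps)
      also have "\<dots> = \<eta> * (norm x)\<^sup>2 / 2" using B(1) by (simp add: \<eta>'_def divide_simps del: distrib_left_numeral)
      also have "\<dots> < \<eta> * (norm x)\<^sup>2" using \<eta> x0 by simp
      finally have lt: "norm ((norm x)\<^sup>2 *\<^sub>R h - x) < \<eta> * (norm x)\<^sup>2" .
      have "h - J x = (1 / (norm x)\<^sup>2) *\<^sub>R ((norm x)\<^sup>2 *\<^sub>R h - x)"
        using x0 by (simp add: J_def scaleR_diff_right)
      then have "dist h (J x) = (1 / (norm x)\<^sup>2) * norm ((norm x)\<^sup>2 *\<^sub>R h - x)"
        by (simp add: dist_norm)
      also have "\<dots> < \<eta>" using lt x0 by (simp add: field_simps)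
      finally show "\<exists>y\<in>?H. dist y (J x) < \<eta>" using h by blast
    qed
  qed
qed

section \<open>The cone as a subset of a normed space\<close>

definition clamp01 :: "real \<Rightarrow> real" where
  "clamp01 t = max 0 (min 1 t)"

lemma clamp01_ge [simp]: "0 \<le> clamp01 t" and clamp01_le [simp]: "clamp01 t \<le> 1"
  by (simp_all add: clamp01_def)

lemma clamp01_in: "clamp01 t \<in> {0..1}"
  by simp

lemma clamp01_id [simp]: "0 \<le> t \<Longrightarrow> t \<le> 1 \<Longrightarrow> clamp01 t = t"
  by (simp add: clamp01_def)

lemma continuous_on_clamp01 [continuous_intros]: "continuous_on S clamp01"
  unfolding clamp01_def by (intro continuous_intros)

definition toC :: "(real \<Rightarrow>\<^sub>C real) \<Rightarrow> real \<Rightarrow> real" where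
  "toC \<phi> = (\<lambda>t. if t \<in> {0..1} then apply_bcontfun \<phi> t else 0)"

text \<open>Freezing the argument at the endpoints gives a bounded continuous function on the line;
  extension by 0 could destroy continuity there.\<close>

definition ofC :: "(real \<Rightarrow> real) \<Rightarrow> (real \<Rightarrow>\<^sub>C real)" where
  "ofC u = Bcontfun (\<lambda>t. u (clamp01 t))"

lemma apply_ofC [simp]:
  assumes "u \<in> C01"
  shows "apply_bcontfun (ofC u) t = u (clamp01 t)"
proof -
  have cont: "continuous_on {0..1} u" using assms by (simp add: C01_def)
  have "bounded (u ` {0..1})"
    by (intro compact_imp_bounded compact_continuous_image cont) simp
  then have "bounded (range (\<lambda>t. u (clamp01 t)))"
    by (rule bounded_subset) (use clamp01_in in blast)
  moreover have "continuous_on UNIV (\<lambda>t. u (clamp01 t))"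
    by (rule continuous_on_compose2[OF cont continuous_on_clamp01]) (use clamp01_in in blast)
  ultimately show ?thesis
    by (simp add: ofC_def Bcontfun_inverse bcontfun_def)
qed

lemma toC_in_C01 [simp]: "toC \<phi> \<in> C01"
proof -
  have "continuous_on {0..1} (toC \<phi>) \<longleftrightarrow> continuous_on {0..1} (apply_bcontfun \<phi>)"
    by (rule continuous_on_cong) (auto simp: toC_def)
  then show ?thesis by (auto simp: C01_def toC_def)
qed

lemma toC_ofC [simp]: "u \<in> C01 \<Longrightarrow> toC (ofC u) = u"
  by (auto simp: toC_def C01_def fun_eq_iff)

lemma toC_diff: "toC (\<phi> - \<psi>) = (\<lambda>t. toC \<phi> t - toC \<psi> t)"
  by (auto simp: toC_def)

lemma supnorm_le: "(\<And>t. t \<in> {0..1} \<Longrightarrow> \<bar>u t\<bar> \<le> B) \<Longrightarrow> supnorm u \<le> B"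
  unfolding supnorm_def by (intro cSUP_least) auto

lemma abs_le_supnorm:
  assumes "u \<in> C01" "t \<in> {0..1}"
  shows "\<bar>u t\<bar> \<le> supnorm u"
proof -
  have "continuous_on {0..1} (\<lambda>t. \<bar>u t\<bar>)"
    using assms by (auto simp: C01_def intro: continuous_intros)
  then have "bdd_above ((\<lambda>t. \<bar>u t\<bar>) ` {0..1})"
    by (intro bounded_imp_bdd_above compact_imp_bounded compact_continuous_image) auto
  then show ?thesis unfolding supnorm_def using assms(2) by (rule cSUP_upper2) simp
qed

lemma supnorm_toC_le: "supnorm (toC \<phi>) \<le> norm \<phi>"
  by (rule supnorm_le) (use norm_bounded[of \<phi>] in \<open>simp add: toC_def\<close>)

lemma bounded_linear_apply_bcontfun: "bounded_linear (\<lambda>\<phi>. apply_bcontfun \<phi> t :: real)"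
  by (rule bounded_linear_intro[where K = 1]) (use norm_bounded in \<open>auto simp flip: real_norm_def\<close>)

lemma norm_const_bcontfun: "0 \<le> r \<Longrightarrow> norm (const_bcontfun r :: real \<Rightarrow>\<^sub>C real) = r"
  using norm_bounded[of "const_bcontfun r :: real \<Rightarrow>\<^sub>C real" 0]
  by (intro antisym norm_bound) auto

text \<open>The copy of the cone \<open>K\<close> in the normed space of bounded continuous functions: an element
  of \<open>C([0,1])\<close> is extended to the real line by its boundary values, so that norms agree.
  Writing \<open>min u \<ge> c \<parallel>u\<parallel>\<close> pointwise makes the cone visibly convex and closed.\<close>

definition coneB :: "real \<Rightarrow> real \<Rightarrow> real \<Rightarrow> (real \<Rightarrow>\<^sub>C real) set" where
  "coneB a b c = {\<phi>. (\<forall>t. apply_bcontfun \<phi> t = apply_bcontfun \<phi> (clamp01 t)) \<and>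
     (\<forall>t. 0 \<le> apply_bcontfun \<phi> t) \<and>
     (\<forall>t\<in>{a..b}. \<forall>s. c * apply_bcontfun \<phi> s \<le> apply_bcontfun \<phi> t)}"

lemma supnorm_toC_coneB:
  assumes "\<phi> \<in> coneB a b c"
  shows "supnorm (toC \<phi>) = norm \<phi>"
proof (rule antisym[OF supnorm_toC_le])
  show "norm \<phi> \<le> supnorm (toC \<phi>)"
  proof (rule norm_bound)
    fix t
    have "apply_bcontfun \<phi> t = toC \<phi> (clamp01 t)"
      using assms by (simp add: coneB_def toC_def)
    then show "norm (apply_bcontfun \<phi> t) \<le> supnorm (toC \<phi>)"
      using abs_le_supnorm[OF toC_in_C01 clamp01_in] by simp
  qed
qed

lemma coneB_scaleR: "\<phi> \<in> coneB a b c \<Longrightarrow> 0 \<le> r \<Longrightarrow> r *\<^sub>R \<phi> \<in> coneB a b c"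
  by (auto simp: coneB_def mult_left_mono mult.left_commute[of c])

lemma convex_coneB: "convex (coneB a b c)"
proof (rule convexI)
  fix x y and u v :: real assume "x \<in> coneB a b c" "y \<in> coneB a b c" "0 \<le> u" "0 \<le> v"
  then have "u *\<^sub>R x \<in> coneB a b c" "v *\<^sub>R y \<in> coneB a b c" by (auto intro: coneB_scaleR)
  then show "u *\<^sub>R x + v *\<^sub>R y \<in> coneB a b c"
    by (auto simp: coneB_def distrib_left intro!: add_mono)
qed

lemma const_in_coneB: "0 \<le> r \<Longrightarrow> c \<le> 1 \<Longrightarrow> const_bcontfun r \<in> coneB a b c"
  using mult_right_mono[of c 1 r] by (simp add: coneB_def)

lemma toC_in_coneK:
  assumes "0 \<le> a" "a \<le> b" "b \<le> 1" "0 < c" "\<phi> \<in> coneB a b c"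
  shows "toC \<phi> \<in> coneK a b c"
proof -
  have "c * supnorm (toC \<phi>) \<le> toC \<phi> t" if "t \<in> {a..b}" for t
  proof -
    have "supnorm (toC \<phi>) \<le> toC \<phi> t / c"
      using assms that by (intro supnorm_le) (auto simp: toC_def coneB_def field_simps)
    then show ?thesis using assms by (simp add: field_simps)
  qed
  then have "(INF t\<in>{a..b}. toC \<phi> t) \<ge> c * supnorm (toC \<phi>)"
    using assms by (intro cINF_greatest) auto
  moreover have "0 \<le> toC \<phi> t" for t using assms by (simp add: toC_def coneB_def)
  ultimately show ?thesis by (simp add: coneK_def)
qed

lemma coneK_lower:
  assumes "0 \<le> a" "b \<le> 1" "u \<in> coneK a b c" "t \<in> {a..b}"
  shows "c * supnorm u \<le> u t"
proof -
  have "bdd_below (u ` {a..b})"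
    using assms by (intro bdd_belowI2[of _ 0]) (auto simp: coneK_def)
  then have "(INF t\<in>{a..b}. u t) \<le> u t" using assms(4) by (rule cINF_lower)
  then show ?thesis using assms(3) by (simp add: coneK_def)
qed

lemma ofC_in_coneB:
  assumes "0 \<le> a" "b \<le> 1" "0 < c" "u \<in> coneK a b c"
  shows "ofC u \<in> coneB a b c"
proof -
  have u: "u \<in> C01" "\<And>t. t \<in> {0..1} \<Longrightarrow> 0 \<le> u t" using assms by (auto simp: coneK_def)
  have "c * u (clamp01 s) \<le> u (clamp01 t)" if t: "t \<in> {a..b}" for s t
  proof -
    have "c * u (clamp01 s) \<le> c * supnorm u"
      using abs_le_supnorm[OF u(1) clamp01_in, of s] assms by simp
    also have "\<dots> \<le> u t" using assms t by (intro coneK_lower)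
    finally show ?thesis using t assms by simp
  qed
  moreover have "clamp01 (clamp01 t) = clamp01 t" for t by (simp add: clamp01_def)
  ultimately show ?thesis using u clamp01_in by (simp add: coneB_def)
qed

section \<open>Envelopes and compact sets in the two representations of the cone\<close>

lemma fconvex_fconvex_hull: "fconvex (fconvex hull S)"
  by (rule hull_in) (auto simp: fconvex_def)

text \<open>\<open>toC\<close> is linear and does not increase the norm. Hence the preimage of a
  convex set of functions is convex, and both balls and closures are respected.\<close>

lemma envelopeI:
  assumes K: "0 \<le> a" "a \<le> b" "b \<le> 1" "0 < c"
    and T: "T \<in> coneK a b c \<rightarrow> coneK a b c"
    and env: "\<And>e. e > 0 \<Longrightarrow>
      x \<in> closure (convex hull ((\<lambda>\<phi>. ofC (T (toC \<phi>))) ` (cball x e \<inter> coneB a b c)))"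
  shows "toC x \<in> envelope T (coneK a b c) (toC x)"
  unfolding envelope_def
proof (intro INT_I)
  fix e :: real assume "e \<in> {e. e > 0}"
  then have e: "e > 0" by simp
  let ?X = "(\<lambda>\<phi>. ofC (T (toC \<phi>))) ` (cball x e \<inter> coneB a b c)"
  let ?Y = "T ` (cball_sup (toC x) e \<inter> coneK a b c)"
  have "?X \<subseteq> {w. toC w \<in> fconvex hull ?Y}"
  proof (clarify intro!: hull_inc)
    fix \<phi> assume \<phi>: "\<phi> \<in> cball x e" "\<phi> \<in> coneB a b c"
    have inK: "toC \<phi> \<in> coneK a b c" using toC_in_coneK K \<phi>(2) by blast
    have "supnorm (\<lambda>t. toC \<phi> t - toC x t) \<le> e"
      using supnorm_toC_le[of "\<phi> - x"] \<phi>(1) by (simp add: toC_diff dist_norm norm_minus_commute)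
    then have "toC \<phi> \<in> cball_sup (toC x) e" by (simp add: cball_sup_def)
    moreover have "toC (ofC (T (toC \<phi>))) = T (toC \<phi>)"
      using T inK by (intro toC_ofC) (auto simp: coneK_def)
    ultimately show "toC (ofC (T (toC \<phi>))) \<in> ?Y" using inK by simp
  qed
  moreover have "convex {w. toC w \<in> fconvex hull ?Y}"
  proof (rule convexI)
    fix y z and u v :: real
    assume yz: "y \<in> {w. toC w \<in> fconvex hull ?Y}" "z \<in> {w. toC w \<in> fconvex hull ?Y}"
      and uv: "0 \<le> u" "0 \<le> v" "u + v = 1"
    then have "(\<lambda>t. u * toC y t + (1 - u) * toC z t) \<in> fconvex hull ?Y"
      using fconvex_fconvex_hull[of ?Y] unfolding fconvex_def by auto
    also have "(\<lambda>t. u * toC y t + (1 - u) * toC z t) = toC (u *\<^sub>R y + v *\<^sub>R z)"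
      using uv by (auto simp: toC_def fun_eq_iff)
    finally show "u *\<^sub>R y + v *\<^sub>R z \<in> {w. toC w \<in> fconvex hull ?Y}" by simp
  qed
  ultimately have hull: "convex hull ?X \<subseteq> {w. toC w \<in> fconvex hull ?Y}"
    by (rule hull_minimal)
  show "toC x \<in> cco ?Y"
    unfolding cco_def closure_sup_def
  proof (intro CollectI conjI toC_in_C01 allI impI)
    fix \<eta> :: real assume "\<eta> > 0"
    then obtain w where w: "w \<in> convex hull ?X" "dist w x < \<eta>"
      using env[OF e] unfolding closure_approachable by blast
    have "supnorm (\<lambda>t. toC x t - toC w t) < \<eta>"
      using supnorm_toC_le[of "x - w"] w(2) by (simp add: toC_diff dist_norm norm_minus_commute)
    then show "\<exists>w\<in>fconvex hull ?Y. supnorm (\<lambda>t. toC x t - w t) < \<eta>"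
      using w(1) hull by blast
  qed
qed

text \<open>Arzela-Ascoli on \<open>{0..1}\<close>: the bound \<omega> supplies equicontinuity at
  each point. All defining conditions are pointwise inequalities or norm bounds and survive the
  limit.\<close>

lemma compact_equicontinuous_coneB:
  assumes \<omega>: "\<And>t e. t \<in> {0..1} \<Longrightarrow> 0 < e \<Longrightarrow>
      \<exists>d>0. \<forall>s\<in>{0..1}. \<bar>t - s\<bar> < d \<longrightarrow> (\<omega> t s :: real) < e"
  shows "compact {\<phi> \<in> coneB a b c. norm \<phi> \<le> B \<and>
      (\<forall>t\<in>{0..1}. \<forall>s\<in>{0..1}. \<bar>apply_bcontfun \<phi> t - apply_bcontfun \<phi> s\<bar> \<le> \<omega> t s)}"
    (is "compact ?E")
  unfolding compact_eq_seq_compact_metric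
proof (rule seq_compactI)
  fix F :: "nat \<Rightarrow> (real \<Rightarrow>\<^sub>C real)" assume F: "\<forall>n. F n \<in> ?E"
  obtain g \<kappa> where \<kappa>: "strict_mono (\<kappa> :: nat \<Rightarrow> nat)"
    and g: "\<And>e. 0 < e \<Longrightarrow> \<exists>N. \<forall>n x. n \<ge> N \<and> x \<in> {0..1} \<longrightarrow> norm (apply_bcontfun (F (\<kappa> n)) x - g x) < e"
  proof (rule Arzela_Ascoli[of "{0..1::real}" "\<lambda>n. apply_bcontfun (F n)" B])
    show "norm (apply_bcontfun (F n) x) \<le> B" for n x
      using F norm_bounded[of "F n" x] by (force intro: order.trans)
    show "\<exists>d>0. \<forall>n y. y \<in> {0..1} \<and> norm (x - y) < d \<longrightarrow> norm (apply_bcontfun (F n) x - apply_bcontfun (F n) y) < e"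
      if x: "x \<in> {0..1}" "0 < e" for x e :: real
    proof -
      obtain d where "d > 0" "\<forall>s\<in>{0..1}. \<bar>x - s\<bar> < d \<longrightarrow> \<omega> x s < e" using \<omega> x by blast
      moreover have "norm (apply_bcontfun (F n) x - apply_bcontfun (F n) y) \<le> \<omega> x y" if "y \<in> {0..1}" for n y
        using F that x by simp
      ultimately show ?thesis by (intro exI[of _ d]) (metis le_less_trans real_norm_def)
    qed
  qed auto
  have clamped: "apply_bcontfun (F n) t = apply_bcontfun (F n) (clamp01 t)" for n t
    using F by (simp add: coneB_def)
  \<comment> \<open>Members of the cone are determined by their values on \<open>{0..1}\<close>, so
    uniform convergence there spreads to the whole line.\<close>
  have "uniform_limit UNIV (\<lambda>n. apply_bcontfun (F (\<kappa> n))) (\<lambda>t. g (clamp01 t)) sequentially"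
  proof (rule uniform_limitI)
    fix e :: real assume "e > 0"
    then obtain N where "\<forall>n x. n \<ge> N \<and> x \<in> {0..1} \<longrightarrow> norm (apply_bcontfun (F (\<kappa> n)) x - g x) < e"
      using g by blast
    then show "\<forall>\<^sub>F n in sequentially. \<forall>t\<in>UNIV. dist (apply_bcontfun (F (\<kappa> n)) t) (g (clamp01 t)) < e"
      unfolding eventually_sequentially dist_norm
      by (intro exI[of _ N]) (metis clamped clamp01_in)
  qed
  then obtain l where l: "(\<lambda>n. F (\<kappa> n)) \<longlonglongrightarrow> l"
    by (rule uniform_limit_bcontfunE) auto
  have pt: "(\<lambda>n. apply_bcontfun (F (\<kappa> n)) t) \<longlonglongrightarrow> apply_bcontfun l t" for t
    by (rule tendsto_uniform_limitI[OF tendsto_bcontfun_uniform_limit[OF l]]) simp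
  have "l \<in> coneB a b c"
    unfolding coneB_def
  proof (intro CollectI conjI allI ballI)
    fix t
    show "apply_bcontfun l t = apply_bcontfun l (clamp01 t)"
      using LIMSEQ_unique[OF pt[of t]] pt[of "clamp01 t"] clamped by simp
    show "0 \<le> apply_bcontfun l t"
      by (rule LIMSEQ_le_const[OF pt]) (use F in \<open>auto simp: coneB_def\<close>)
    fix s assume "t \<in> {a..b}"
    then show "c * apply_bcontfun l s \<le> apply_bcontfun l t"
      using F by (intro LIMSEQ_le[OF tendsto_mult_left[OF pt] pt]) (auto simp: coneB_def)
  qed
  moreover have "norm l \<le> B"
    by (rule LIMSEQ_le_const2[OF tendsto_norm[OF l]]) (use F in auto)
  moreover have "\<bar>apply_bcontfun l t - apply_bcontfun l s\<bar> \<le> \<omega> t s" if "t \<in> {0..1}" "s \<in> {0..1}" for t s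
    by (rule LIMSEQ_le_const2[OF tendsto_rabs[OF tendsto_diff[OF pt pt]]]) (use F that in auto)
  ultimately have "l \<in> ?E" by simp
  then show "\<exists>l\<in>?E. \<exists>r. strict_mono r \<and> (F \<circ> r) \<longlonglongrightarrow> l"
    using \<kappa> l by (intro bexI[of _ l] exI[of _ \<kappa>]) (simp_all add: o_def)
qed

lemma convex_equicontinuous_coneB:
  "convex {\<phi> \<in> coneB a b c. norm \<phi> \<le> B \<and>
      (\<forall>t\<in>{0..1}. \<forall>s\<in>{0..1}. \<bar>apply_bcontfun \<phi> t - apply_bcontfun \<phi> s\<bar> \<le> (\<omega> t s :: real))}"
proof (rule convexI, clarify, intro conjI ballI)
  fix x y and u v :: real
  assume x: "x \<in> coneB a b c" "norm x \<le> B" and y: "y \<in> coneB a b c" "norm y \<le> B"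
    and uv: "0 \<le> u" "0 \<le> v" "u + v = 1"
    and xw: "\<forall>t\<in>{0..1}. \<forall>s\<in>{0..1}. \<bar>apply_bcontfun x t - apply_bcontfun x s\<bar> \<le> \<omega> t s"
    and yw: "\<forall>t\<in>{0..1}. \<forall>s\<in>{0..1}. \<bar>apply_bcontfun y t - apply_bcontfun y s\<bar> \<le> \<omega> t s"
  show "u *\<^sub>R x + v *\<^sub>R y \<in> coneB a b c"
    using convexD[OF convex_coneB] x y uv by blast
  show "norm (u *\<^sub>R x + v *\<^sub>R y) \<le> B"
    using convexD[OF convex_cball[of 0 B]] x y uv by simp
  fix t s :: real assume ts: "t \<in> {0..1}" "s \<in> {0..1}"
  have "apply_bcontfun (u *\<^sub>R x + v *\<^sub>R y) t - apply_bcontfun (u *\<^sub>R x + v *\<^sub>R y) s =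
      u * (apply_bcontfun x t - apply_bcontfun x s) + v * (apply_bcontfun y t - apply_bcontfun y s)"
    by (simp add: algebra_simps)
  also have "\<bar>\<dots>\<bar> \<le> u * \<bar>apply_bcontfun x t - apply_bcontfun x s\<bar> + v * \<bar>apply_bcontfun y t - apply_bcontfun y s\<bar>"
    by (rule order.trans[OF abs_triangle_ineq]) (use uv in \<open>simp add: abs_mult\<close>)
  also have "\<dots> \<le> u * \<omega> t s + v * \<omega> t s"
    using xw yw ts uv by (intro add_mono mult_left_mono) auto
  also have "\<dots> = \<omega> t s" using uv by (simp flip: distrib_right)
  finally show "\<bar>apply_bcontfun (u *\<^sub>R x + v *\<^sub>R y) t - apply_bcontfun (u *\<^sub>R x + v *\<^sub>R y) s\<bar> \<le> \<omega> t s" .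
qed

section \<open>The Hammerstein operator\<close>

locale hammerstein_kernel =
  fixes a b c :: real
    and f :: "real \<Rightarrow> real \<Rightarrow> real"
    and g \<Phi> :: "real \<Rightarrow> real"
    and k :: "real \<Rightarrow> real \<Rightarrow> real"
  assumes ab: "0 \<le> a" "a \<le> b" "b \<le> 1"
    and c: "0 < c" "c \<le> 1"
    and f_nonneg: "\<And>t u. t \<in> {0..1} \<Longrightarrow> 0 \<le> u \<Longrightarrow> 0 \<le> f t u"
    and f_meas: "\<And>u. u \<in> C01 \<Longrightarrow> (\<lambda>s. f s (u s)) \<in> borel_measurable (lebesgue_on {0..1})"
    and f_bound: "\<And>r. r > 0 \<Longrightarrow> \<exists>R>0. AE t in lebesgue_on {0..1}. \<forall>u\<in>{0..r}. f t u \<le> R"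
    and g_meas: "g \<in> borel_measurable (lebesgue_on {0..1})"
    and g_nonneg: "AE s in lebesgue_on {0..1}. 0 \<le> g s"
    and k_cont: "continuous_on ({0..1} \<times> {0..1}) (\<lambda>p. k (fst p) (snd p))"
    and k_nonneg: "\<And>t s. t \<in> {0..1} \<Longrightarrow> s \<in> {0..1} \<Longrightarrow> 0 \<le> k t s"
    and \<Phi>_nonneg: "\<And>s. s \<in> {0..1} \<Longrightarrow> 0 \<le> \<Phi> s"
    and \<Phi>g_int: "integrable (lebesgue_on {0..1}) (\<lambda>s. \<Phi> s * g s)"
    and \<Phi>g_pos: "integral\<^sup>L (lebesgue_on {a..b}) (\<lambda>s. \<Phi> s * g s) > 0"
    and k_upper: "\<And>t s. t \<in> {0..1} \<Longrightarrow> s \<in> {0..1} \<Longrightarrow> k t s \<le> \<Phi> s"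
    and k_lower: "\<And>t s. t \<in> {a..b} \<Longrightarrow> s \<in> {0..1} \<Longrightarrow> c * \<Phi> s \<le> k t s"
begin

section \<open>Integrability of the kernel and its modulus of continuity\<close>

abbreviation T :: "(real \<Rightarrow> real) \<Rightarrow> real \<Rightarrow> real" where
  "T \<equiv> hammerstein k g f"

abbreviation M :: "real measure" where
  "M \<equiv> lebesgue_on {0..1}"

text \<open>Times a bound for \<open>f\<close>, this weighted L^1 distance of kernel sections is a
  modulus of continuity common to all images under \<open>T\<close> of functions with a given
  bound.\<close>

definition \<omega> :: "real \<Rightarrow> real \<Rightarrow> real" where
  "\<omega> t t' = (\<integral>s. \<bar>k t s - k t' s\<bar> * g s \<partial>M)"

lemma k_meas: "t \<in> {0..1} \<Longrightarrow> k t \<in> borel_measurable M"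
proof (rule continuous_imp_measurable_on_sets_lebesgue)
  assume t: "t \<in> {0..1}"
  have "continuous_on {0..1} (\<lambda>s. k (fst (t, s)) (snd (t, s)))"
    by (rule continuous_on_compose2[OF k_cont]) (use t in \<open>auto intro!: continuous_intros\<close>)
  then show "continuous_on {0..1} (k t)" by simp
qed simp

lemma AE_in: "AE s in M. s \<in> {0..1}"
  using AE_space[of M] by simp

lemma kg_int: "integrable M (\<lambda>s. k t s * g s)" if t: "t \<in> {0..1}"
proof (rule Bochner_Integration.integrable_bound[OF \<Phi>g_int])
  show "(\<lambda>s. k t s * g s) \<in> borel_measurable M"
    using k_meas[OF t] g_meas by simp
  show "AE s in M. norm (k t s * g s) \<le> norm (\<Phi> s * g s)"
    using AE_in
    by eventually_elim (use t k_nonneg k_upper \<Phi>_nonneg in \<open>auto simp: abs_mult intro!: mult_right_mono\<close>)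
qed

lemma kg_le: "(\<integral>s. k t s * g s \<partial>M) \<le> (\<integral>s. \<Phi> s * g s \<partial>M)" if t: "t \<in> {0..1}"
proof (rule integral_mono_AE[OF kg_int[OF t] \<Phi>g_int])
  show "AE s in M. k t s * g s \<le> \<Phi> s * g s"
    using AE_in g_nonneg by eventually_elim (use k_upper[OF t] in \<open>auto intro!: mult_right_mono\<close>)
qed

lemma \<omega>_int: "integrable M (\<lambda>s. \<bar>k t s - k t' s\<bar> * g s)" if t: "t \<in> {0..1}" "t' \<in> {0..1}"
proof (rule Bochner_Integration.integrable_bound[OF integrable_mult_right[OF \<Phi>g_int, of 2]])
  show "(\<lambda>s. \<bar>k t s - k t' s\<bar> * g s) \<in> borel_measurable M"
    using k_meas[OF t(1)] k_meas[OF t(2)] g_meas by simp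
  show "AE s in M. norm (\<bar>k t s - k t' s\<bar> * g s) \<le> norm (2 * (\<Phi> s * g s))"
    using AE_in
  proof eventually_elim
    case (elim s)
    then have "\<bar>k t s - k t' s\<bar> \<le> 2 * \<Phi> s"
      using k_nonneg[OF t(1), of s] k_nonneg[OF t(2), of s] k_upper[OF t(1), of s] k_upper[OF t(2), of s] by simp
    then have "\<bar>k t s - k t' s\<bar> * \<bar>g s\<bar> \<le> 2 * \<Phi> s * \<bar>g s\<bar>" by (rule mult_right_mono) simp
    then show ?case using elim \<Phi>_nonneg[of s] by (simp add: abs_mult)
  qed
qed

text \<open>Continuity of the kernel gives pointwise convergence of the integrands, and dominated
  convergence applies with majorant \<open>2 * (\<Phi> s * g s)\<close>.\<close>

lemma \<omega>_small:
  assumes t: "t \<in> {0..1}" and e: "0 < e"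
  shows "\<exists>d>0. \<forall>s\<in>{0..1}. \<bar>t - s\<bar> < d \<longrightarrow> \<omega> t s < e"
proof -
  have "continuous_on {0..1} (\<omega> t)"
  proof (rule continuous_on_sequentiallyI)
    fix X y assume X: "\<forall>n. X n \<in> {0..1}" and y: "y \<in> {0..1::real}" and lim: "X \<longlonglongrightarrow> y"
    show "(\<lambda>n. \<omega> t (X n)) \<longlonglongrightarrow> \<omega> t y"
      unfolding \<omega>_def
    proof (rule integral_dominated_convergence[where w = "\<lambda>s. 2 * (\<Phi> s * g s)"])
      show "(\<lambda>s. \<bar>k t s - k y s\<bar> * g s) \<in> borel_measurable M"
        using k_meas[OF t] k_meas[OF y] g_meas by simp
      show "(\<lambda>s. \<bar>k t s - k (X n) s\<bar> * g s) \<in> borel_measurable M" for n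
        using k_meas[OF t] k_meas[of "X n"] X g_meas by simp
      show "integrable M (\<lambda>s. 2 * (\<Phi> s * g s))" using \<Phi>g_int by simp
      show "AE s in M. (\<lambda>n. \<bar>k t s - k (X n) s\<bar> * g s) \<longlonglongrightarrow> \<bar>k t s - k y s\<bar> * g s"
        using AE_in
      proof eventually_elim
        case (elim s)
        have "(\<lambda>n. k (fst (X n, s)) (snd (X n, s))) \<longlonglongrightarrow> k (fst (y, s)) (snd (y, s))"
          by (rule continuous_on_tendsto_compose[OF k_cont]) (use lim elim X y in \<open>auto intro: tendsto_intros\<close>)
        then show ?case by (auto intro!: tendsto_intros)
      qed
      show "AE s in M. norm (\<bar>k t s - k (X n) s\<bar> * g s) \<le> 2 * (\<Phi> s * g s)" for n
        using AE_in g_nonneg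
      proof eventually_elim
        case (elim s)
        have Xn: "X n \<in> {0..1}" using X by blast
        have "\<bar>k t s - k (X n) s\<bar> \<le> 2 * \<Phi> s"
          using elim k_nonneg[OF t, of s] k_nonneg[OF Xn, of s] k_upper[OF t, of s] k_upper[OF Xn, of s] by simp
        then have "\<bar>k t s - k (X n) s\<bar> * g s \<le> 2 * \<Phi> s * g s" using elim(2) by (rule mult_right_mono)
        then show ?case using elim by (simp add: abs_mult)
      qed
    qed
  qed
  moreover have "\<omega> t t = 0" by (simp add: \<omega>_def)
  ultimately obtain d where "d > 0" "\<And>s. s \<in> {0..1} \<Longrightarrow> dist s t < d \<Longrightarrow> dist (\<omega> t s) 0 < e"
    using t e unfolding continuous_on_iff by metis
  then show ?thesis
    by (intro exI[of _ d]) (force simp: dist_real_def abs_minus_commute)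
qed

section \<open>The operator on nonnegative functions with a given bound\<close>

context
  fixes u :: "real \<Rightarrow> real" and r R :: real
  assumes u: "u \<in> C01" "\<And>s. s \<in> {0..1} \<Longrightarrow> 0 \<le> u s \<and> u s \<le> r"
    and R: "0 \<le> R" "AE t in M. \<forall>v\<in>{0..r}. f t v \<le> R"
begin

text \<open>The exceptional null set for the bound on \<open>f\<close> is the same for all
  \<open>v\<close>, which permits the substitution \<open>v = u s\<close>.\<close>

lemma fu_bounds: "AE s in M. 0 \<le> f s (u s) \<and> f s (u s) \<le> R"
  using AE_in R(2) by eventually_elim (use u f_nonneg in auto)

lemma kgf_int: "integrable M (\<lambda>s. k t s * g s * f s (u s))" if t: "t \<in> {0..1}"
proof (rule Bochner_Integration.integrable_bound[OF integrable_mult_left[OF kg_int[OF t], of R]])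
  show "(\<lambda>s. k t s * g s * f s (u s)) \<in> borel_measurable M"
    using k_meas[OF t] g_meas f_meas[OF u(1)] by simp
  show "AE s in M. norm (k t s * g s * f s (u s)) \<le> norm (k t s * g s * R)"
    using fu_bounds by eventually_elim (auto simp: abs_mult intro!: mult_left_mono)
qed

lemma T_eq: "t \<in> {0..1} \<Longrightarrow> T u t = (\<integral>s. k t s * g s * f s (u s) \<partial>M)"
  by (simp add: hammerstein_def)

lemma T_nonneg: "0 \<le> T u t"
proof (cases "t \<in> {0..1}")
  case t: True
  show ?thesis unfolding T_eq[OF t]
  proof (rule integral_nonneg_AE)
    show "AE s in M. 0 \<le> k t s * g s * f s (u s)"
      using AE_in g_nonneg fu_bounds by eventually_elim (use k_nonneg[OF t] in auto)
  qed
next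
  case False
  then show ?thesis unfolding hammerstein_def by (simp only: if_False)
qed

lemma T_upper: "T u t \<le> R * (\<integral>s. k t s * g s \<partial>M)" if t: "t \<in> {0..1}"
proof -
  have "T u t \<le> (\<integral>s. R * (k t s * g s) \<partial>M)"
    unfolding T_eq[OF t]
  proof (rule integral_mono_AE[OF kgf_int[OF t]])
    show "integrable M (\<lambda>s. R * (k t s * g s))" using kg_int[OF t] by simp
    show "AE s in M. k t s * g s * f s (u s) \<le> R * (k t s * g s)"
      using AE_in g_nonneg fu_bounds
    proof eventually_elim
      case (elim s)
      then have "k t s * g s * f s (u s) \<le> k t s * g s * R"
        using k_nonneg[OF t, of s] by (intro mult_left_mono) auto
      then show ?case by (simp add: mult.commute)
    qed
  qed
  then show ?thesis by simp
qed

lemma T_modulus: "\<bar>T u t - T u t'\<bar> \<le> R * \<omega> t t'" if t: "t \<in> {0..1}" and t': "t' \<in> {0..1}"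
proof -
  have eq: "T u t - T u t' = (\<integral>s. k t s * g s * f s (u s) - k t' s * g s * f s (u s) \<partial>M)"
    unfolding T_eq[OF t] T_eq[OF t'] by (rule Bochner_Integration.integral_diff[OF kgf_int[OF t] kgf_int[OF t'], symmetric])
  have "\<bar>T u t - T u t'\<bar> \<le> (\<integral>s. \<bar>k t s * g s * f s (u s) - k t' s * g s * f s (u s)\<bar> \<partial>M)"
    unfolding eq by (rule integral_abs_bound)
  also have "\<dots> \<le> (\<integral>s. R * (\<bar>k t s - k t' s\<bar> * g s) \<partial>M)"
  proof (rule integral_mono_AE)
    show "integrable M (\<lambda>s. \<bar>k t s * g s * f s (u s) - k t' s * g s * f s (u s)\<bar>)"
      by (rule integrable_abs[OF Bochner_Integration.integrable_diff[OF kgf_int[OF t] kgf_int[OF t']]])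
    show "integrable M (\<lambda>s. R * (\<bar>k t s - k t' s\<bar> * g s))" using \<omega>_int[OF t t'] by simp
    show "AE s in M. \<bar>k t s * g s * f s (u s) - k t' s * g s * f s (u s)\<bar> \<le> R * (\<bar>k t s - k t' s\<bar> * g s)"
      using g_nonneg fu_bounds
    proof eventually_elim
      case (elim s)
      have "\<bar>k t s * g s * f s (u s) - k t' s * g s * f s (u s)\<bar> = \<bar>(k t s - k t' s) * g s * f s (u s)\<bar>"
        by (simp add: left_diff_distrib)
      also have "\<dots> = \<bar>k t s - k t' s\<bar> * g s * f s (u s)" using elim by (simp add: abs_mult)
      also have "\<dots> \<le> \<bar>k t s - k t' s\<bar> * g s * R" using elim by (intro mult_left_mono) auto
      finally show ?case by (simp add: mult.commute)
    qed
  qed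
  also have "\<dots> = R * \<omega> t t'" by (simp add: \<omega>_def)
  finally show ?thesis .
qed

lemma T_cone: "c * T u t' \<le> T u t" if t: "t \<in> {a..b}" and t': "t' \<in> {0..1}"
proof -
  have t1: "t \<in> {0..1}" using t ab by auto
  have "c * T u t' = (\<integral>s. c * (k t' s * g s * f s (u s)) \<partial>M)"
    by (simp add: T_eq[OF t'])
  also have "\<dots> \<le> T u t"
    unfolding T_eq[OF t1]
  proof (rule integral_mono_AE[OF _ kgf_int[OF t1]])
    show "integrable M (\<lambda>s. c * (k t' s * g s * f s (u s)))" using kgf_int[OF t'] by simp
    show "AE s in M. c * (k t' s * g s * f s (u s)) \<le> k t s * g s * f s (u s)"
      using AE_in g_nonneg fu_bounds
    proof eventually_elim
      case (elim s)
      have "c * k t' s \<le> c * \<Phi> s" using k_upper[OF t' elim(1)] c by simp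
      also have "\<dots> \<le> k t s" using k_lower[OF t elim(1)] .
      finally have "c * k t' s * (g s * f s (u s)) \<le> k t s * (g s * f s (u s))"
        using elim by (intro mult_right_mono) auto
      then show ?case by (simp add: mult.assoc)
    qed
  qed
  finally show ?thesis .
qed

lemma T_in_C01: "T u \<in> C01"
proof -
  have "continuous_on {0..1} (T u)"
    unfolding continuous_on_iff
  proof (intro ballI allI impI)
    fix t e :: real assume t: "t \<in> {0..1}" and e: "0 < e"
    \<comment> \<open>The denominator is \<open>R + 1\<close> because \<open>R\<close> may be
      0.\<close>
    then obtain d where d: "d > 0" "\<forall>s\<in>{0..1}. \<bar>t - s\<bar> < d \<longrightarrow> \<omega> t s < e / (R + 1)"
      using \<omega>_small[OF t, of "e / (R + 1)"] R by auto
    have "dist (T u s) (T u t) < e" if s: "s \<in> {0..1}" "dist s t < d" for s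
    proof -
      have w: "\<omega> t s < e / (R + 1)" using d s by (auto simp: dist_real_def abs_minus_commute)
      have "\<bar>T u t - T u s\<bar> \<le> R * \<omega> t s" using T_modulus t s by blast
      also have "\<dots> \<le> R * (e / (R + 1))" using w R by (intro mult_left_mono) auto
      also have "\<dots> < e" using e R by (simp add: field_simps)
      finally show ?thesis by (simp add: dist_real_def abs_minus_commute)
    qed
    then show "\<exists>d>0. \<forall>s\<in>{0..1}. dist s t < d \<longrightarrow> dist (T u s) (T u t) < e" using d(1) by blast
  qed
  then show ?thesis by (simp add: C01_def hammerstein_def)
qed

lemma T_in_coneK: "T u \<in> coneK a b c"
proof -
  have "c * supnorm (T u) \<le> T u t" if t: "t \<in> {a..b}" for t
  proof -
    have "supnorm (T u) \<le> T u t / c"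
      using T_cone[OF t] T_nonneg c by (intro supnorm_le) (simp add: field_simps)
    then show ?thesis using c by (simp add: field_simps)
  qed
  then have "(INF t\<in>{a..b}. T u t) \<ge> c * supnorm (T u)"
    using ab by (intro cINF_greatest) auto
  then show ?thesis using T_in_C01 T_nonneg by (simp add: coneK_def)
qed

end

section \<open>The operator on the cone in the normed space\<close>

abbreviation P :: "(real \<Rightarrow>\<^sub>C real) set" where
  "P \<equiv> coneB a b c"

definition TB :: "(real \<Rightarrow>\<^sub>C real) \<Rightarrow> (real \<Rightarrow>\<^sub>C real)" where
  "TB \<phi> = ofC (T (toC \<phi>))"

lemma toC_bounds: "\<phi> \<in> P \<Longrightarrow> norm \<phi> \<le> r \<Longrightarrow> s \<in> {0..1} \<Longrightarrow> 0 \<le> toC \<phi> s \<and> toC \<phi> s \<le> r"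
  using norm_bounded[of \<phi> s] by (auto simp: toC_def coneB_def)

lemma coneK_maps: "T \<in> coneK a b c \<rightarrow> coneK a b c"
proof
  fix u assume u: "u \<in> coneK a b c"
  then have u': "u \<in> C01" "\<And>s. s \<in> {0..1} \<Longrightarrow> 0 \<le> u s" by (auto simp: coneK_def)
  \<comment> \<open>Adding 1 makes the radius positive even for the zero function.\<close>
  obtain R where R: "R > 0" "AE t in M. \<forall>v\<in>{0..supnorm u + 1}. f t v \<le> R"
    using f_bound[of "supnorm u + 1"] abs_le_supnorm[OF u'(1), of 0] by fastforce
  show "T u \<in> coneK a b c"
  proof (rule T_in_coneK[OF u'(1) _ less_imp_le[OF R(1)] R(2)])
    show "0 \<le> u s \<and> u s \<le> supnorm u + 1" if "s \<in> {0..1}" for s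
      using u'(2)[OF that] abs_le_supnorm[OF u'(1) that] by auto
  qed
qed

lemma T_toC: "\<phi> \<in> P \<Longrightarrow> T (toC \<phi>) \<in> coneK a b c"
  using coneK_maps toC_in_coneK[OF ab c(1)] by blast

lemma apply_TB: "\<phi> \<in> P \<Longrightarrow> apply_bcontfun (TB \<phi>) t = T (toC \<phi>) (clamp01 t)"
  using T_toC[of \<phi>] by (simp add: TB_def coneK_def)

text \<open>The images of a ball share a norm bound and a modulus of continuity. Taking all cone
  elements with these two bounds gives a set that is convex and, by equicontinuity, compact.\<close>

lemma TB_compact:
  assumes r: "r > 0"
  obtains C where "compact C" "convex C" "0 \<in> C" "C \<subseteq> P"
    "\<And>\<phi>. \<phi> \<in> P \<Longrightarrow> norm \<phi> \<le> r \<Longrightarrow> TB \<phi> \<in> C"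
proof -
  obtain R where R: "R > 0" "AE t in M. \<forall>v\<in>{0..r}. f t v \<le> R"
    using f_bound[OF r] by blast
  define B where "B = R * (\<integral>s. \<Phi> s * g s \<partial>M)"
  define C where "C = {\<phi> \<in> P. norm \<phi> \<le> B \<and>
      (\<forall>t\<in>{0..1}. \<forall>s\<in>{0..1}. \<bar>apply_bcontfun \<phi> t - apply_bcontfun \<phi> s\<bar> \<le> R * \<omega> t s)}"
  show ?thesis
  proof (rule that)
    show "compact C"
      unfolding C_def
    proof (rule compact_equicontinuous_coneB)
      fix t e :: real assume "t \<in> {0..1}" "0 < e"
      then obtain d where "d > 0" "\<forall>s\<in>{0..1}. \<bar>t - s\<bar> < d \<longrightarrow> \<omega> t s < e / R"
        using \<omega>_small[of t "e / R"] R by auto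
      then show "\<exists>d>0. \<forall>s\<in>{0..1}. \<bar>t - s\<bar> < d \<longrightarrow> R * \<omega> t s < e"
        using R(1) by (auto simp: field_simps)
    qed
    show "convex C" unfolding C_def by (rule convex_equicontinuous_coneB)
    show "C \<subseteq> P" by (auto simp: C_def)
    show TBC: "TB \<phi> \<in> C" if \<phi>: "\<phi> \<in> P" "norm \<phi> \<le> r" for \<phi>
    proof -
      note T = toC_in_C01[of \<phi>] toC_bounds[OF \<phi>] less_imp_le[OF R(1)] R(2)
      have "norm (apply_bcontfun (TB \<phi>) t) \<le> B" for t
      proof -
        have "T (toC \<phi>) (clamp01 t) \<le> R * (\<integral>s. k (clamp01 t) s * g s \<partial>M)"
          by (rule T_upper[OF T clamp01_in])
        also have "\<dots> \<le> B" unfolding B_def using R(1) kg_le[OF clamp01_in] by simp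
        finally show ?thesis using T_nonneg[OF T] by (simp add: apply_TB[OF \<phi>(1)])
      qed
      then have "norm (TB \<phi>) \<le> B" by (rule norm_bound)
      moreover have "TB \<phi> \<in> P" unfolding TB_def
        using ofC_in_coneB[OF ab(1,3) c(1) T_toC[OF \<phi>(1)]] .
      moreover have "\<bar>apply_bcontfun (TB \<phi>) t - apply_bcontfun (TB \<phi>) s\<bar> \<le> R * \<omega> t s"
        if "t \<in> {0..1}" "s \<in> {0..1}" for t s
        using T_modulus[OF T that] that by (simp add: apply_TB[OF \<phi>(1)])
      ultimately show ?thesis by (simp add: C_def)
    qed
    \<comment> \<open>\<open>B\<close> is nonnegative because it dominates the norm of
      \<open>TB 0\<close>; hence 0 satisfies both bounds.\<close>
    have "0 \<in> P" by (simp add: coneB_def)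
    then have "TB 0 \<in> C" using TBC[of 0] r by simp
    then have B: "0 \<le> B" using norm_ge_zero[of "TB 0"] unfolding C_def by (simp del: norm_ge_zero)
    moreover have "0 \<le> \<omega> t s" for t s
      unfolding \<omega>_def using g_nonneg by (intro integral_nonneg_AE) auto
    ultimately show "0 \<in> C" using \<open>0 \<in> P\<close> R(1) by (simp add: C_def)
  qed
qed

section \<open>Contraction and expansion near spheres from the growth conditions on
  \<open>f\<close>\<close>

lemma AE_sub: "AE s in lebesgue_on {a..b}. Q s" if "AE s in M. Q s"
  using that ab by (subst (asm) AE_restrict_space_iff, simp, subst AE_restrict_space_iff, simp) (auto elim: eventually_mono)

lemma kg_int_sub: "integrable (lebesgue_on {a..b}) (\<lambda>s. k t s * g s)" if "t \<in> {0..1}"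
proof -
  have "set_integrable lebesgue {0..1} (\<lambda>s. k t s * g s)"
    using kg_int[OF that] by (simp add: set_integrable_def integrable_restrict_space)
  then have "set_integrable lebesgue {a..b} (\<lambda>s. k t s * g s)"
    by (rule set_integrable_subset) (use ab in auto)
  then show ?thesis by (simp add: set_integrable_def integrable_restrict_space)
qed

text \<open>This is the source of positivity for the supremum and the infimum whose reciprocals are
  \<open>m_const\<close> and \<open>M_const\<close>.\<close>

lemma kg_sub_le:
  assumes t: "t \<in> {a..b}"
  shows "c * (\<integral>s. \<Phi> s * g s \<partial>lebesgue_on {a..b}) \<le> (\<integral>s. k t s * g s \<partial>lebesgue_on {a..b})"
proof -
  have t1: "t \<in> {0..1}" using t ab by auto
  have "(\<integral>s. c * (\<Phi> s * g s) \<partial>lebesgue_on {a..b}) \<le> (\<integral>s. k t s * g s \<partial>lebesgue_on {a..b})"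
  proof (rule integral_mono_lebesgue_on_AE[OF kg_int_sub[OF t1]])
    have "AE s in M. c * (\<Phi> s * g s) \<le> k t s * g s"
      using AE_in g_nonneg
      by eventually_elim (use k_lower[OF t] in \<open>auto simp: mult.assoc[symmetric] intro!: mult_right_mono\<close>)
    then show "AE s in lebesgue_on {a..b}. c * (\<Phi> s * g s) \<le> k t s * g s" by (rule AE_sub)
    have "AE s in M. 0 \<le> k t s * g s"
      using AE_in g_nonneg by eventually_elim (use k_nonneg[OF t1] in auto)
    then show "AE s in lebesgue_on {a..b}. 0 \<le> k t s * g s" by (rule AE_sub)
  qed auto
  then show ?thesis by simp
qed

text \<open>The strict inequality leaves room for a \<open>q\<close> with
  \<open>f \<le> q * \<rho>\<close> and \<open>q * S < 1\<close>. The norm of the image is then at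
  most \<open>q * \<rho> * S\<close>, which falls short of \<rho> by
  \<open>\<rho> * (1 - q * S)\<close>.\<close>

lemma I1_norm:
  assumes \<rho>: "0 < \<rho>" and I1: "cond_I1 f k g \<rho>"
  obtains e where "0 < e" "e \<le> \<rho>" "\<And>\<phi>. \<phi> \<in> P \<Longrightarrow> norm \<phi> \<le> \<rho> + e \<Longrightarrow> norm (TB \<phi>) \<le> \<rho> - e"
proof -
  define S where "S = (SUP t\<in>{0..1}. \<integral>s. k t s * g s \<partial>M)"
  have bdd: "bdd_above ((\<lambda>t. \<integral>s. k t s * g s \<partial>M) ` {0..1})"
    by (rule bdd_aboveI2[OF kg_le])
  have upS: "(\<integral>s. k t s * g s \<partial>M) \<le> S" if "t \<in> {0..1}" for t
    unfolding S_def using bdd that by (rule cSUP_upper2) simp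
  have "0 < S"
  proof -
    have a: "a \<in> {a..b}" "a \<in> {0..1}" using ab by auto
    have "0 < c * (\<integral>s. \<Phi> s * g s \<partial>lebesgue_on {a..b})" using c \<Phi>g_pos by simp
    also have "\<dots> \<le> (\<integral>s. k a s * g s \<partial>lebesgue_on {a..b})" using kg_sub_le[OF a(1)] .
    also have "\<dots> \<le> (\<integral>s. k a s * g s \<partial>M)"
    proof (rule integral_mono_lebesgue_on_AE[OF kg_int[OF a(2)]])
      show "AE s in M. 0 \<le> k a s * g s"
        using AE_in g_nonneg by eventually_elim (use k_nonneg[OF a(2)] in auto)
    qed (use ab in auto)
    also have "\<dots> \<le> S" using upS[OF a(2)] .
    finally show ?thesis .
  qed
  obtain \<epsilon> where \<epsilon>: "\<epsilon> > 0"
    and sup: "(SUP p\<in>{0..1} \<times> {0..\<rho> + \<epsilon>}. ereal (f (fst p) (snd p) / \<rho>)) < ereal (1 / S)"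
    using I1 unfolding cond_I1_def m_const_def S_def by blast
  obtain q where q: "(SUP p\<in>{0..1} \<times> {0..\<rho> + \<epsilon>}. ereal (f (fst p) (snd p) / \<rho>)) < ereal q" "q < 1 / S"
    using ereal_dense2[OF sup] by auto
  have fq: "f t v \<le> q * \<rho>" if "t \<in> {0..1}" "v \<in> {0..\<rho> + \<epsilon>}" for t v
  proof -
    have "ereal (f t v / \<rho>) \<le> (SUP p\<in>{0..1} \<times> {0..\<rho> + \<epsilon>}. ereal (f (fst p) (snd p) / \<rho>))"
      by (rule SUP_upper2[of "(t, v)"]) (use that in auto)
    from le_less_trans[OF this q(1)] have "f t v / \<rho> < q" by simp
    then show ?thesis using \<rho> by (simp add: field_simps)
  qed
  \<comment> \<open>\<open>q\<close> comes from density only; its sign is read off from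
    \<open>f 0 0\<close>.\<close>
  have q0: "0 \<le> q * \<rho>" using f_nonneg[of 0 0] fq[of 0 0] \<rho> \<epsilon> by force
  have qS: "q * S < 1" using q(2) \<open>0 < S\<close> by (simp add: field_simps)
  define e where "e = min \<epsilon> (min \<rho> (\<rho> * (1 - q * S)))"
  have e: "0 < e" "e \<le> \<rho>" "e \<le> \<epsilon>" "e \<le> \<rho> * (1 - q * S)"
    using \<epsilon> \<rho> qS by (auto simp: e_def)
  show ?thesis
  proof (rule that[OF e(1,2)])
    fix \<phi> assume \<phi>: "\<phi> \<in> P" "norm \<phi> \<le> \<rho> + e"
    have le: "norm \<phi> \<le> \<rho> + \<epsilon>" using \<phi> e by simp
    have AEq: "AE t in M. \<forall>v\<in>{0..\<rho> + \<epsilon>}. f t v \<le> q * \<rho>"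
      using AE_in by eventually_elim (use fq in blast)
    note T = toC_in_C01[of \<phi>] toC_bounds[OF \<phi>(1) le] q0 AEq
    show "norm (TB \<phi>) \<le> \<rho> - e"
    proof (rule norm_bound)
      fix t
      have "T (toC \<phi>) (clamp01 t) \<le> q * \<rho> * (\<integral>s. k (clamp01 t) s * g s \<partial>M)"
        by (rule T_upper[OF T clamp01_in])
      also have "\<dots> \<le> q * \<rho> * S" by (intro mult_left_mono upS clamp01_in q0)
      also have "\<dots> = \<rho> - \<rho> * (1 - q * S)" by (simp add: algebra_simps)
      also have "\<dots> \<le> \<rho> - e" using e(4) by simp
      finally show "norm (apply_bcontfun (TB \<phi>) t) \<le> \<rho> - e"
        using T_nonneg[OF T] by (simp add: apply_TB[OF \<phi>(1)])
    qed
  qed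
qed

text \<open>The integral at \<open>a\<close> is cut down to \<open>{a..b}\<close>, where the cone
  inequality keeps the values of \<open>toC \<phi>\<close> in the range covered by the condition.
  Evaluation at \<open>a\<close> is the linear functional required by the annulus lemmas.\<close>

lemma I0_lower:
  assumes \<rho>: "0 < \<rho>" and I0: "cond_I0 f k g a b c \<rho>"
  obtains e where "0 < e"
    "\<And>\<phi>. \<phi> \<in> P \<Longrightarrow> \<bar>norm \<phi> - \<rho>\<bar> \<le> e \<Longrightarrow> \<rho> + e \<le> apply_bcontfun (TB \<phi>) a"
proof -
  define I where "I = (INF t\<in>{a..b}. \<integral>s. k t s * g s \<partial>lebesgue_on {a..b})"
  have a: "a \<in> {a..b}" "a \<in> {0..1}" using ab by auto
  have Ipos: "0 < I"
  proof -
    have "c * (\<integral>s. \<Phi> s * g s \<partial>lebesgue_on {a..b}) \<le> I"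
      unfolding I_def using a kg_sub_le by (intro cINF_greatest) auto
    then show ?thesis using c \<Phi>g_pos by (smt (verit) mult_pos_pos)
  qed
  have Ia: "I \<le> (\<integral>s. k a s * g s \<partial>lebesgue_on {a..b})"
    unfolding I_def by (rule cINF_lower[OF bdd_belowI2 a(1)]) (rule kg_sub_le)
  obtain \<epsilon> where \<epsilon>: "\<epsilon> > 0" and inf: "ereal (1 / I) <
     (INF p\<in>{a..b} \<times> ({c * (\<rho> - \<epsilon>)..\<rho> / c + \<epsilon>} \<inter> {0..}). ereal (f (fst p) (snd p) / \<rho>))"
    using I0 unfolding cond_I0_def M_const_def I_def by blast
  obtain q where q: "1 / I < q"
    "ereal q < (INF p\<in>{a..b} \<times> ({c * (\<rho> - \<epsilon>)..\<rho> / c + \<epsilon>} \<inter> {0..}). ereal (f (fst p) (snd p) / \<rho>))"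
    using ereal_dense2[OF inf] by auto
  have fq: "q * \<rho> \<le> f t v" if "t \<in> {a..b}" "c * (\<rho> - \<epsilon>) \<le> v" "v \<le> \<rho> / c + \<epsilon>" "0 \<le> v" for t v
  proof -
    have "(INF p\<in>{a..b} \<times> ({c * (\<rho> - \<epsilon>)..\<rho> / c + \<epsilon>} \<inter> {0..}). ereal (f (fst p) (snd p) / \<rho>)) \<le> ereal (f t v / \<rho>)"
      by (rule INF_lower2[of "(t, v)"]) (use that in auto)
    from less_le_trans[OF q(2) this] have "q < f t v / \<rho>" by simp
    then show ?thesis using \<rho> by (simp add: field_simps)
  qed
  have q0: "0 < q" using q(1) Ipos by (meson less_trans zero_less_divide_1_iff)
  have qI: "1 < q * I" using q(1) Ipos by (simp add: field_simps)
  define e where "e = min \<epsilon> (\<rho> * (q * I - 1))"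
  have e: "0 < e" "e \<le> \<epsilon>" "e \<le> \<rho> * (q * I - 1)" using \<epsilon> \<rho> qI by (auto simp: e_def)
  show ?thesis
  proof (rule that[OF e(1)])
    fix \<phi> assume \<phi>: "\<phi> \<in> P" "\<bar>norm \<phi> - \<rho>\<bar> \<le> e"
    have range: "c * (\<rho> - \<epsilon>) \<le> toC \<phi> s" "toC \<phi> s \<le> \<rho> / c + \<epsilon>" "0 \<le> toC \<phi> s" if s: "s \<in> {a..b}" for s
    proof -
      have s1: "s \<in> {0..1}" using s ab by auto
      have "c * (\<rho> - \<epsilon>) \<le> c * norm \<phi>" using \<phi>(2) e(2) c by (intro mult_left_mono) auto
      also have "\<dots> \<le> toC \<phi> s"
        using coneK_lower[OF ab(1,3) toC_in_coneK[OF ab c(1) \<phi>(1)] s] supnorm_toC_coneB[OF \<phi>(1)] by simp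
      finally show "c * (\<rho> - \<epsilon>) \<le> toC \<phi> s" .
      have "\<rho> \<le> \<rho> / c" using c \<rho> by (simp add: field_simps)
      then show "toC \<phi> s \<le> \<rho> / c + \<epsilon>" "0 \<le> toC \<phi> s"
        using toC_bounds[OF \<phi>(1) order.refl s1] \<phi>(2) e(2) by auto
    qed
    \<comment> \<open>\<open>R\<close> serves the integrability over \<open>{0..1}\<close>; the
      lower estimate comes from \<open>q\<close>.\<close>
    have pos: "\<rho> + e > 0" using \<rho> e by simp
    obtain R where R: "R > 0" "AE t in M. \<forall>v\<in>{0..\<rho> + e}. f t v \<le> R"
      using f_bound[OF pos] by blast
    have le: "norm \<phi> \<le> \<rho> + e" using \<phi>(2) by simp
    note T = toC_in_C01[of \<phi>] toC_bounds[OF \<phi>(1) le] less_imp_le[OF R(1)] R(2)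
    have "\<rho> + e \<le> q * \<rho> * I" using e(3) by (simp add: algebra_simps)
    also have "\<dots> \<le> q * \<rho> * (\<integral>s. k a s * g s \<partial>lebesgue_on {a..b})"
      using Ia q0 \<rho> by (intro mult_left_mono) auto
    also have "\<dots> = (\<integral>s. q * \<rho> * (k a s * g s) \<partial>lebesgue_on {a..b})" by simp
    also have "\<dots> \<le> (\<integral>s. k a s * g s * f s (toC \<phi> s) \<partial>M)"
    proof (rule integral_mono_lebesgue_on_AE[OF kgf_int[OF T a(2)]])
      have "AE s in M. s \<in> {a..b} \<longrightarrow> q * \<rho> * (k a s * g s) \<le> k a s * g s * f s (toC \<phi> s)"
        using AE_in g_nonneg
      proof eventually_elim
        case (elim s)
        show ?case
        proof
          assume s: "s \<in> {a..b}"
          have "k a s * g s * (q * \<rho>) \<le> k a s * g s * f s (toC \<phi> s)"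
            using k_nonneg[OF a(2) elim(1)] elim(2) fq[OF s range[OF s]] by (intro mult_left_mono) auto
          then show "q * \<rho> * (k a s * g s) \<le> k a s * g s * f s (toC \<phi> s)" by (simp add: mult.commute)
        qed
      qed
      from AE_sub[OF this] AE_space[of "lebesgue_on {a..b}"]
      show "AE s in lebesgue_on {a..b}. q * \<rho> * (k a s * g s) \<le> k a s * g s * f s (toC \<phi> s)"
        by eventually_elim simp
      have "AE s in M. 0 \<le> f s (toC \<phi> s) \<and> f s (toC \<phi> s) \<le> R"
        by (rule fu_bounds[OF T])
      with AE_in g_nonneg show "AE s in M. 0 \<le> k a s * g s * f s (toC \<phi> s)"
        by eventually_elim (use k_nonneg[OF a(2)] in auto)
    qed (use ab in auto)
    also have "\<dots> = apply_bcontfun (TB \<phi>) a"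
      using a(2) by (simp add: apply_TB[OF \<phi>(1)] hammerstein_def)
    finally show "\<rho> + e \<le> apply_bcontfun (TB \<phi>) a" .
  qed
qed

section \<open>Nonzero envelope fixed points of the Hammerstein operator\<close>

lemma compression:
  assumes "0 < \<rho>1" "\<rho>1 < \<rho>2" "cond_I0 f k g a b c \<rho>1" "cond_I1 f k g \<rho>2"
  obtains x where "x \<in> P" "0 < norm x"
    "\<And>d. d > 0 \<Longrightarrow> x \<in> closure (convex hull (TB ` (cball x d \<inter> P)))"
proof -
  have \<rho>2: "0 < \<rho>2" using assms by simp
  obtain e1 where e1: "0 < e1"
    "\<And>\<phi>. \<phi> \<in> P \<Longrightarrow> \<bar>norm \<phi> - \<rho>1\<bar> \<le> e1 \<Longrightarrow> \<rho>1 + e1 \<le> apply_bcontfun (TB \<phi>) a"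
    using I0_lower[OF assms(1,3)] by blast
  obtain e2 where e2: "0 < e2" "e2 \<le> \<rho>2" "\<And>\<phi>. \<phi> \<in> P \<Longrightarrow> norm \<phi> \<le> \<rho>2 + e2 \<Longrightarrow> norm (TB \<phi>) \<le> \<rho>2 - e2"
    using I1_norm[OF \<rho>2 assms(4)] by blast
  obtain C where C: "compact C" "convex C" "0 \<in> C" "C \<subseteq> P"
    "\<And>\<phi>. \<phi> \<in> P \<Longrightarrow> norm \<phi> \<le> \<rho>2 \<Longrightarrow> TB \<phi> \<in> C"
    using TB_compact[OF \<rho>2] by blast
  define e where "e = min e1 e2"
  have e: "0 < e" "e \<le> e1" "e \<le> e2" using e1(1) e2(1) by (auto simp: e_def)
  obtain x where x: "x \<in> {x \<in> P. \<rho>1 \<le> norm x \<and> norm x \<le> \<rho>2}"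
    "\<And>d. d > 0 \<Longrightarrow> x \<in> closure (convex hull (TB ` (cball x d \<inter> {x \<in> P. \<rho>1 \<le> norm x \<and> norm x \<le> \<rho>2})))"
  proof (rule cone_compression_envelope[OF C(1-4) bounded_linear_apply_bcontfun[of a] _ assms(2) e(1)])
    show "apply_bcontfun x a \<le> norm x" for x :: "real \<Rightarrow>\<^sub>C real" using norm_bounded[of x a] by simp
    show "e \<le> \<rho>2" using e e2 by simp
    show "TB \<in> {x \<in> P. \<rho>1 \<le> norm x \<and> norm x \<le> \<rho>2} \<rightarrow> C" using C(5) by auto
    show "\<rho>1 + e \<le> apply_bcontfun (TB x) a" if "x \<in> P" "\<rho>1 \<le> norm x" "norm x \<le> \<rho>1 + e" for x
      using e1(2)[OF that(1)] that e by auto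
    show "norm (TB x) \<le> \<rho>2 - e" if "x \<in> P" "\<rho>2 - e \<le> norm x" "norm x \<le> \<rho>2" for x
      using e2(3)[OF that(1)] that e by auto
    \<comment> \<open>A constant function serves as the required cone point on the inner sphere; it
      lies in the cone because \<open>c \<le> 1\<close>.\<close>
    show "const_bcontfun \<rho>1 \<in> P" using assms c by (intro const_in_coneB) auto
    show "norm (const_bcontfun \<rho>1 :: real \<Rightarrow>\<^sub>C real) = \<rho>1" using assms by (simp add: norm_const_bcontfun)
  qed blast
  show ?thesis
  proof (rule that)
    show "x \<in> P" "0 < norm x" using x(1) assms by auto
    show "x \<in> closure (convex hull (TB ` (cball x d \<inter> P)))" if "d > 0" for d
      using x(2)[OF that] by (rule subsetD[OF closure_mono[OF hull_mono], rotated]) auto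
  qed
qed

lemma expansion:
  assumes "0 < \<rho>1" "\<rho>1 < \<rho>2" "cond_I1 f k g \<rho>1" "cond_I0 f k g a b c \<rho>2"
  obtains x where "x \<in> P" "0 < norm x"
    "\<And>d. d > 0 \<Longrightarrow> x \<in> closure (convex hull (TB ` (cball x d \<inter> P)))"
proof -
  have \<rho>2: "0 < \<rho>2" using assms by simp
  obtain e1 where e1: "0 < e1"
    "\<And>\<phi>. \<phi> \<in> P \<Longrightarrow> \<bar>norm \<phi> - \<rho>2\<bar> \<le> e1 \<Longrightarrow> \<rho>2 + e1 \<le> apply_bcontfun (TB \<phi>) a"
    using I0_lower[OF \<rho>2 assms(4)] by blast
  obtain e2 where e2: "0 < e2" "e2 \<le> \<rho>1" "\<And>\<phi>. \<phi> \<in> P \<Longrightarrow> norm \<phi> \<le> \<rho>1 + e2 \<Longrightarrow> norm (TB \<phi>) \<le> \<rho>1 - e2"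
    using I1_norm[OF assms(1,3)] by blast
  obtain C where C: "compact C" "convex C" "0 \<in> C" "C \<subseteq> P"
    "\<And>\<phi>. \<phi> \<in> P \<Longrightarrow> norm \<phi> \<le> \<rho>2 \<Longrightarrow> TB \<phi> \<in> C"
    using TB_compact[OF \<rho>2] by blast
  define e where "e = min e1 e2"
  have e: "0 < e" "e \<le> e1" "e \<le> e2" using e1(1) e2(1) by (auto simp: e_def)
  obtain x where x: "x \<in> {x \<in> P. \<rho>1 \<le> norm x \<and> norm x \<le> \<rho>2}"
    "\<And>d. d > 0 \<Longrightarrow> x \<in> closure (convex hull (TB ` (cball x d \<inter> {x \<in> P. \<rho>1 \<le> norm x \<and> norm x \<le> \<rho>2})))"
  proof (rule cone_expansion_envelope[OF C(1-4) coneB_scaleR bounded_linear_apply_bcontfun[of a] _ assms(1,2) e(1)])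
    show "apply_bcontfun x a \<le> norm x" for x :: "real \<Rightarrow>\<^sub>C real" using norm_bounded[of x a] by simp
    show "e \<le> \<rho>1" using e e2 by simp
    show "TB \<in> {x \<in> P. \<rho>1 \<le> norm x \<and> norm x \<le> \<rho>2} \<rightarrow> C" using C(5) by auto
    show "\<rho>2 + e \<le> apply_bcontfun (TB x) a" if "x \<in> P" "\<rho>2 - e \<le> norm x" "norm x \<le> \<rho>2" for x
      using e1(2)[OF that(1)] that e by auto
    show "norm (TB x) \<le> \<rho>1 - e" if "x \<in> P" "\<rho>1 \<le> norm x" "norm x \<le> \<rho>1 + e" for x
      using e2(3)[OF that(1)] that e by auto
    show "const_bcontfun \<rho>2 \<in> P" using \<rho>2 c by (intro const_in_coneB) auto
    show "norm (const_bcontfun \<rho>2 :: real \<Rightarrow>\<^sub>C real) = \<rho>2" using \<rho>2 by (simp add: norm_const_bcontfun)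
  qed blast+
  show ?thesis
  proof (rule that)
    show "x \<in> P" "0 < norm x" using x(1) assms by auto
    show "x \<in> closure (convex hull (TB ` (cball x d \<inter> P)))" if "d > 0" for d
      using x(2)[OF that] by (rule subsetD[OF closure_mono[OF hull_mono], rotated]) auto
  qed
qed

end

theorem theorem5:
  fixes a b c :: real
    and f :: "real \<Rightarrow> real \<Rightarrow> real"
    and g \<Phi> :: "real \<Rightarrow> real"
    and k :: "real \<Rightarrow> real \<Rightarrow> real"
  assumes ab: "0 \<le> a" "a \<le> b" "b \<le> 1"
    and c: "0 < c" "c \<le> 1"
    and H1_nonneg: "\<forall>t\<in>{0..1}. \<forall>u\<ge>0. 0 \<le> f t u"
    and H1_meas: "\<forall>u\<in>C01. (\<lambda>s. f s (u s)) \<in> borel_measurable (lebesgue_on {0..1})"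
    and H1_bound: "\<forall>r>0. \<exists>R>0. AE t in lebesgue_on {0..1}. \<forall>u\<in>{0..r}. f t u \<le> R"
    and H2: "g \<in> borel_measurable (lebesgue_on {0..1})"
      "AE s in lebesgue_on {0..1}. 0 \<le> g s"
    and H3: "continuous_on ({0..1} \<times> {0..1}) (\<lambda>p. k (fst p) (snd p))"
      "\<forall>t\<in>{0..1}. \<forall>s\<in>{0..1}. 0 \<le> k t s"
    and H4: "\<Phi> \<in> borel_measurable (lebesgue_on {0..1})"
      "\<forall>s\<in>{0..1}. 0 \<le> \<Phi> s"
      "integrable (lebesgue_on {0..1}) (\<lambda>s. \<Phi> s * g s)"
      "integral\<^sup>L (lebesgue_on {a..b}) (\<lambda>s. \<Phi> s * g s) > 0"
      "\<forall>t\<in>{0..1}. \<forall>s\<in>{0..1}. k t s \<le> \<Phi> s"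
      "\<forall>t\<in>{a..b}. \<forall>s\<in>{0..1}. c * \<Phi> s \<le> k t s"
    and env: "\<forall>u\<in>coneK a b c. u \<in> envelope_set (hammerstein k g f) (coneK a b c) \<longrightarrow>
                 u \<in> envelope (hammerstein k g f) (coneK a b c) u \<longrightarrow> u = hammerstein k g f u"
    and cases: "(\<exists>\<rho>1 \<rho>2. 0 < \<rho>1 \<and> 0 < \<rho>2 \<and> \<rho>1 / c < \<rho>2 \<and>
                     cond_I0 f k g a b c \<rho>1 \<and> cond_I1 f k g \<rho>2)
              \<or> (\<exists>\<rho>1 \<rho>2. 0 < \<rho>1 \<and> 0 < \<rho>2 \<and> \<rho>1 < \<rho>2 \<and>
                     cond_I1 f k g \<rho>1 \<and> cond_I0 f k g a b c \<rho>2)"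
  shows "\<exists>u\<in>coneK a b c. hammerstein k g f u = u \<and> supnorm u > 0"
proof -
  interpret hammerstein_kernel a b c f g \<Phi> k
    using ab c H1_nonneg H1_meas H1_bound H2 H3 H4 by unfold_locales blast+
  obtain x where x: "x \<in> coneB a b c" "0 < norm x"
    and xenv: "\<And>d. d > 0 \<Longrightarrow> x \<in> closure (convex hull (TB ` (cball x d \<inter> coneB a b c)))"
    using cases
  proof (elim disjE exE conjE)
    fix \<rho>1 \<rho>2 :: real
    assume \<rho>: "0 < \<rho>1" "\<rho>1 / c < \<rho>2" "cond_I0 f k g a b c \<rho>1" "cond_I1 f k g \<rho>2"
    have "\<rho>1 \<le> \<rho>1 / c" using \<rho>(1) c by (simp add: field_simps)
    then have "\<rho>1 < \<rho>2" using \<rho>(2) by linarith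
    then show thesis using compression \<rho> that by blast
  next
    fix \<rho>1 \<rho>2 :: real
    assume \<rho>: "0 < \<rho>1" "\<rho>1 < \<rho>2" "cond_I1 f k g \<rho>1" "cond_I0 f k g a b c \<rho>2"
    then show thesis using expansion that by blast
  qed
  have xK: "toC x \<in> coneK a b c" using toC_in_coneK[OF ab c(1) x(1)] .
  \<comment> \<open>Membership in the envelope at the point itself also gives membership in the
    union over the cone, so both premises of \<open>env\<close> hold.\<close>
  have "toC x \<in> envelope (hammerstein k g f) (coneK a b c) (toC x)"
    using envelopeI[OF ab c(1) coneK_maps] xenv by (simp add: TB_def)
  moreover from this have "toC x \<in> envelope_set (hammerstein k g f) (coneK a b c)"
    using xK by (auto simp: envelope_set_def)
  ultimately have "toC x = hammerstein k g f (toC x)" using env xK by blast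
  then show ?thesis using xK x supnorm_toC_coneB[OF x(1)] by (intro bexI[of _ "toC x"]) auto
qed

end
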